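(* Let $q$ be a positive integer and let $\mathscr{B}\colon X\to^? q$ be a Borel CSP on a standard Borel space $X$. Suppose that the graph $G_{\mathscr{B}}$ is hyperfinite and that \[ \mathsf{p}(\mathscr{B})\,(\mathsf{d}(\mathscr{B})+1)^{2}\,\leq\, e^{-2}. \] If $\mu$ is a probability Borel measure on $X$, then $\mathscr{B}$ has a $\mu$-measurable solution.
   Context: $q\in\mathbb{N}$ is identified with $\{0,\dots,q-1\}$. CSPs. Let $X$ be a set and $q$ a positive integer. An $(X,q)$-constraint with domain a finite set $D\subseteq X$ is a set $B\subseteq q^D$ of functions $D\to q$; write $\mathrm{dom}(B)=D$. A function $f\colon X\to q$ violates $B$ if $f|_{\mathrm{dom}(B)}\in B$, and satisfies $B$ otherwise. A constraint satisfaction problem (CSP) $\mathscr{B}\colon X\to^? q$ is a set of $(X,q)$-constraints; a solution to it is a function $f\colon X\to q$ satisfying every $B\in\mathscr{B}$. Put $\mathbb{P}[B]=|B|/q^{|\mathrm{dom}(B)|}$, $\mathsf{p}(\mathscr{B})=\sup_{B\in\mathscr{B}}\mathbb{P}[B]$, and $\mathsf{d}(\mathscr{B})=\sup_{B\in\mathscr{B}}|\{B'\in\mathscr{B}: B'\neq B,\ \mathrm{dom}(B')\cap\mathrm{dom}(B)\neq\varnothing\}|$. Inequalities involving $\mathsf{d}(\mathscr{B})$ are understood to include $\mathsf{d}(\mathscr{B})<\infty$. $G_{\mathscr{B}}$ is the graph with vertex set $X$ in which distinct $x,y$ are adjacent iff some $B\in\mathscr{B}$ has $x,y\in\mathrm{dom}(B)$.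 Borel CSPs. For a standard Borel space $X$, the set $[X]^k$ of $k$-element subsets carries the quotient standard Borel structure from the $k$-tuples of distinct points, and the set $[X]^{<\infty}=\bigsqcup_k[X]^k$ of finite subsets carries the disjoint union structure. The set of finite partial functions $X\rightharpoonup q$ (identified with their graphs) is a Borel subset of $[X\times q]^{<\infty}$. The set $\mathrm{Const}(X,q)$ of all $(X,q)$-constraints, viewed as finite sets of finite partial functions $X\rightharpoonup q$ with a common domain, is a Borel subset of the space of finite subsets of that space, hence is standard Borel. A CSP $\mathscr{B}\colon X\to^? q$ is Borel if it is a Borel subset of $\mathrm{Const}(X,q)$. (If $\mathscr{B}$ is Borel and $\mathsf{d}(\mathscr{B})<\infty$, then $G_{\mathscr{B}}$ is a locally finite Borel graph, i.e. its adjacency relation is Borel in $X^2$.) A Borel graph $G$ is hyperfinite if there is an increasing sequence $G_0\subseteq G_1\subseteq\cdots\subseteq G$ of Borel subgraphs of $G$ (graphs on Borel subsets of $V(G)$ with Borel adjacency relation), each having only finite connected components, whose union is $G$. A function $f\colon X\to q$ is $\mu$-measurable if each $f^{-1}(i)$, $0\le i<q$, is $\mu$-measurable. *)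

theory Defs
  imports "HOL-Probability.Probability"
begin

section \<open>Standard Borel spaces and spaces of finite subsets\<close>

text \<open>
  A Borel space is a value of type \<^typ>\<open>'a measure\<close> of which only the carrier \<^const>\<open>space\<close> and
  the sigma-algebra \<^const>\<open>sets\<close> matter.
\<close>

definition standard_borel :: "'a measure \<Rightarrow> bool" where
  "standard_borel M \<longleftrightarrow>
     (\<exists>T. completely_metrizable_space T \<and> second_countable T \<and> topspace T = space M \<and>
          sets M = sigma_sets (topspace T) {U. openin T U})"

definition distinct_tuples :: "'a measure \<Rightarrow> nat \<Rightarrow> (nat \<Rightarrow> 'a) measure" where
  "distinct_tuples M k = restrict_space (\<Pi>\<^sub>M i\<in>{..<k}. M) {x. inj_on x {..<k}}"

text \<open>
  The quotient structure on the \<open>k\<close>-element subsets, for every \<open>k\<close>, and the disjoint union structure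
  on all finite subsets, in one step: a family of finite sets is Borel iff for every \<open>k\<close> the set of
  \<open>k\<close>-tuples of distinct points enumerating a member of the family is Borel.
\<close>

definition finite_subsets :: "'a measure \<Rightarrow> 'a set measure" where
  "finite_subsets M = sigma {F. finite F \<and> F \<subseteq> space M}
     {A. A \<subseteq> {F. finite F \<and> F \<subseteq> space M} \<and>
         (\<forall>k. {x \<in> space (distinct_tuples M k). x ` {..<k} \<in> A} \<in> sets (distinct_tuples M k))}"

lemma space_finite_subsets: "space (finite_subsets M) = {F. finite F \<and> F \<subseteq> space M}"
  by (simp add: finite_subsets_def space_measure_of_conv)

text \<open>The generating family above is already a sigma-algebra.\<close>

lemma sets_finite_subsets:
  "sets (finite_subsets M) =
     {A. A \<subseteq> {F. finite F \<and> F \<subseteq> space M} \<and>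
         (\<forall>k. {x \<in> space (distinct_tuples M k). x ` {..<k} \<in> A} \<in> sets (distinct_tuples M k))}"
  (is "_ = ?S")
proof -
  let ?F = "{F. finite F \<and> F \<subseteq> space M}"
  let ?P = "\<lambda>k A. {x \<in> space (distinct_tuples M k). x ` {..<k} \<in> A}"
  have img: "x ` {..<k} \<in> ?F" if "x \<in> space (distinct_tuples M k)" for x k
    using that by (auto simp: distinct_tuples_def space_restrict_space space_PiM)
  have "sigma_algebra ?F ?S"
  proof (rule sigma_algebra_iff2[THEN iffD2], intro conjI ballI allI impI)
    show "?S \<subseteq> Pow ?F" "{} \<in> ?S" by auto
  next
    fix A assume A: "A \<in> ?S"
    have "?P k (?F - A) = space (distinct_tuples M k) - ?P k A" for k
      using img[of _ k] by blast
    with A show "?F - A \<in> ?S" by auto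
  next
    fix A :: "nat \<Rightarrow> 'a set set" assume A: "range A \<subseteq> ?S"
    have "?P k (\<Union>i. A i) = (\<Union>i. ?P k (A i))" for k by blast
    moreover have "?P k (A i) \<in> sets (distinct_tuples M k)" "A i \<subseteq> ?F" for i k
      using A by blast+
    ultimately have "?P k (\<Union>i. A i) \<in> sets (distinct_tuples M k)" for k
      by (simp only:) (rule sets.countable_UN, blast)
    moreover have "(\<Union>i. A i) \<subseteq> ?F" using A by blast
    ultimately show "(\<Union>i. A i) \<in> ?S" by blast
  qed
  then show ?thesis
    unfolding finite_subsets_def by (rule sigma_algebra.sets_measure_of_eq)
qed

section \<open>Constraint satisfaction problems\<close>

text \<open>
  Finite partial functions to \<open>q = {..<q}\<close> are maps \<^typ>\<open>'a \<rightharpoonup> nat\<close>, and a constraint is a set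
  of such maps with a common domain.
\<close>

type_synonym 'a constraint = "('a \<rightharpoonup> nat) set"

definition constraints :: "'a set \<Rightarrow> nat \<Rightarrow> 'a constraint set" where
  "constraints X q =
     {B. \<exists>D. finite D \<and> D \<subseteq> X \<and> B \<subseteq> {p. dom p = D \<and> ran p \<subseteq> {..<q}}}"

text \<open>
  For nonempty \<open>B\<close> this is the common domain of the members of \<open>B\<close>. The empty set is a constraint with
  respect to every domain; it is assigned the domain \<open>{}\<close>, which makes \<open>csp_d\<close> and \<open>csp_graph\<close> below
  as small as possible.
\<close>

definition cdom :: "'a constraint \<Rightarrow> 'a set" where
  "cdom B = (\<Union>p\<in>B. dom p)"

definition violates :: "('a \<Rightarrow> nat) \<Rightarrow> 'a constraint \<Rightarrow> bool" where
  "violates f B \<longleftrightarrow> (\<lambda>x. Some (f x)) |` cdom B \<in> B"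

definition csp_solution :: "'a set \<Rightarrow> nat \<Rightarrow> 'a constraint set \<Rightarrow> ('a \<Rightarrow> nat) \<Rightarrow> bool" where
  "csp_solution X q \<B> f \<longleftrightarrow> f \<in> X \<rightarrow> {..<q} \<and> (\<forall>B\<in>\<B>. \<not> violates f B)"

definition constraint_prob :: "nat \<Rightarrow> 'a constraint \<Rightarrow> real" where
  "constraint_prob q B = real (card B) / real q ^ card (cdom B)"

definition csp_p :: "nat \<Rightarrow> 'a constraint set \<Rightarrow> ennreal" where
  "csp_p q \<B> = (SUP B\<in>\<B>. ennreal (constraint_prob q B))"

definition constraint_nbrs :: "'a constraint set \<Rightarrow> 'a constraint \<Rightarrow> 'a constraint set" where
  "constraint_nbrs \<B> B = {B' \<in> \<B>. B' \<noteq> B \<and> cdom B' \<inter> cdom B \<noteq> {}}"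

definition csp_d :: "'a constraint set \<Rightarrow> enat" where
  "csp_d \<B> = (SUP B\<in>\<B>. if finite (constraint_nbrs \<B> B) then enat (card (constraint_nbrs \<B> B)) else \<infinity>)"

definition pfun_space :: "'a measure \<Rightarrow> nat \<Rightarrow> ('a \<rightharpoonup> nat) measure" where
  "pfun_space M q =
     vimage_algebra {p. finite (dom p) \<and> dom p \<subseteq> space M \<and> ran p \<subseteq> {..<q}}
       Map.graph (finite_subsets (M \<Otimes>\<^sub>M count_space {..<q}))"

definition constraint_space :: "'a measure \<Rightarrow> nat \<Rightarrow> 'a constraint measure" where
  "constraint_space M q =
     restrict_space (finite_subsets (pfun_space M q)) (constraints (space M) q)"

definition borel_csp :: "'a measure \<Rightarrow> nat \<Rightarrow> 'a constraint set \<Rightarrow> bool" where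
  "borel_csp M q \<B> \<longleftrightarrow> \<B> \<in> sets (constraint_space M q)"

section \<open>Borel graphs\<close>

text \<open>A graph is a pair of a vertex set and an adjacency relation.\<close>

type_synonym 'a ugraph = "'a set \<times> ('a \<times> 'a) set"

definition csp_graph :: "'a set \<Rightarrow> 'a constraint set \<Rightarrow> 'a ugraph" where
  "csp_graph X \<B> =
     (X, {(x, y). x \<in> X \<and> y \<in> X \<and> x \<noteq> y \<and> (\<exists>B\<in>\<B>. x \<in> cdom B \<and> y \<in> cdom B)})"

definition borel_graph :: "'a measure \<Rightarrow> 'a ugraph \<Rightarrow> bool" where
  "borel_graph M G \<longleftrightarrow>
     snd G \<subseteq> fst G \<times> fst G \<and> sym (snd G) \<and> irrefl (snd G) \<and>
     fst G \<in> sets M \<and> snd G \<in> sets (M \<Otimes>\<^sub>M M)"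

definition subgraph :: "'a ugraph \<Rightarrow> 'a ugraph \<Rightarrow> bool" where
  "subgraph H G \<longleftrightarrow> fst H \<subseteq> fst G \<and> snd H \<subseteq> snd G"

definition finite_components :: "'a ugraph \<Rightarrow> bool" where
  "finite_components G \<longleftrightarrow> (\<forall>x\<in>fst G. finite {y. (x, y) \<in> (snd G)\<^sup>*})"

definition hyperfinite :: "'a measure \<Rightarrow> 'a ugraph \<Rightarrow> bool" where
  "hyperfinite M G \<longleftrightarrow> borel_graph M G \<and>
     (\<exists>H. (\<forall>n::nat. borel_graph M (H n) \<and> finite_components (H n) \<and>
                    subgraph (H n) (H (Suc n)) \<and> subgraph (H n) G) \<and>
          (\<Union>n. fst (H n)) = fst G \<and> (\<Union>n. snd (H n)) = snd G)"

section \<open>Measurability with respect to a measure\<close>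

text \<open>Being \<open>\<mu>\<close>-measurable means belonging to the completion of \<open>\<mu>\<close>.\<close>

definition mu_measurable :: "'a measure \<Rightarrow> nat \<Rightarrow> ('a \<Rightarrow> nat) \<Rightarrow> bool" where
  "mu_measurable \<mu> q f \<longleftrightarrow> (\<forall>i<q. f -` {i} \<inter> space \<mu> \<in> sets (completion \<mu>))"

end

theory Submission
  imports Defs
begin

text \<open>
  On a set of points that induces a graph with finite components, the classical local lemma can be
  applied to each component separately, and the choices can be made measurably. A hyperfinite
  graph has infinite components in general, but off an invariant null set its points split into two
  measurable parts that each induce a graph with finite components
  (\<open>hyperfinite_split\<close>). Such a splitting costs one factor \<open>e (d + 1)\<close> per part, which is
  what the square in the hypothesis pays for: values on the first part are chosen such that every
  constraint, conditioned on them, is violated with probability below \<open>1 / (e (d + 1))\<close>, and values on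
  the second part such that this conditional probability drops below \<open>1\<close>, which means that the constraint
  is satisfied. Each of the two choices is possible on every finite component by Markov's inequality and
  the local lemma (\<open>extend_partial_assignment\<close>). On the null set a solution comes from compactness
  (\<open>solution_exists\<close>).

  The measurability of all this rests on enumerating the neighbours of a point by measurable functions.
  The sets that arise are projections of Borel sets. The sigma-algebra of universally measurable
  sets contains such projections, by the Souslin operation
  (\<open>projection_univ_measurable\<close>), and is stable under composition
  (\<open>measurable_univ_completion\<close>). For a relation with finite sections this gives countably many
  universally measurable functions which enumerate all sections
  (\<open>measurable_enumeration_of_sections\<close>). Afterwards constraints near a point are described by
  countably many codes, and a measurable choice on the finite components is made by taking the first
  function that works from a suitable countable family (\<open>measurable_extension\<close>).
\<close>

section \<open>Universally measurable sets\<close>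

definition univ_completion :: "'a measure \<Rightarrow> 'a measure" where
  "univ_completion M = sigma (space M)
     {A. A \<subseteq> space M \<and> (\<forall>\<nu>. finite_measure \<nu> \<and> sets \<nu> = sets M \<longrightarrow> A \<in> sets (completion \<nu>))}"

lemma space_univ_completion [simp]: "space (univ_completion M) = space M"
  by (simp add: univ_completion_def space_measure_of_conv)

lemma sets_univ_completion:
  "sets (univ_completion M) =
     {A. A \<subseteq> space M \<and> (\<forall>\<nu>. finite_measure \<nu> \<and> sets \<nu> = sets M \<longrightarrow> A \<in> sets (completion \<nu>))}"
  (is "_ = ?S")
proof -
  have top: "space M \<in> sets (completion \<nu>)" if "sets \<nu> = sets M" for \<nu>
    using sets.top[of "completion \<nu>"] sets_eq_imp_space_eq[OF that] by simp
  have "sigma_algebra (space M) ?S"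
  proof (rule sigma_algebra_iff2[THEN iffD2], intro conjI ballI allI impI)
    fix A assume "A \<in> ?S"
    with top show "space M - A \<in> ?S" by auto
  next
    fix A :: "nat \<Rightarrow> 'a set" assume "range A \<subseteq> ?S"
    then show "(\<Union>i. A i) \<in> ?S" by (auto intro!: sets.countable_UN)
  qed auto
  then show ?thesis
    unfolding univ_completion_def by (rule sigma_algebra.sets_measure_of_eq)
qed

lemma sets_univ_completion_subset_completion:
  assumes "finite_measure \<nu>" "sets \<nu> = sets M"
  shows "sets (univ_completion M) \<subseteq> sets (completion \<nu>)"
  using assms by (auto simp: sets_univ_completion)

lemma sets_subset_sets_univ_completion: "sets M \<subseteq> sets (univ_completion M)"
  by (auto simp: sets_univ_completion dest: sets.sets_into_space)

lemma univ_completion_measurable_completion: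
  assumes f: "f \<in> univ_completion M \<rightarrow>\<^sub>M N" and \<nu>: "finite_measure \<nu>" "sets \<nu> = sets M"
  shows "f \<in> completion \<nu> \<rightarrow>\<^sub>M N"
proof (rule measurableI)
  show "f x \<in> space N" if "x \<in> space (completion \<nu>)" for x
    using measurable_space[OF f, of x] that sets_eq_imp_space_eq[OF \<nu>(2)] by simp
  show "f -` A \<inter> space (completion \<nu>) \<in> sets (completion \<nu>)" if "A \<in> sets N" for A
    using measurable_sets[OF f that] sets_univ_completion_subset_completion[OF \<nu>]
      sets_eq_imp_space_eq[OF \<nu>(2)] by auto
qed

text \<open>
  This closure under composition is what the completion of a single measure lacks: the preimage of
  a null set need not be null. Here the push-forward of a finite measure is again one of the
  measures that a universally measurable set has to be measurable for.
\<close>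

lemma measurable_univ_completion:
  assumes f: "f \<in> univ_completion M \<rightarrow>\<^sub>M N"
  shows "f \<in> univ_completion M \<rightarrow>\<^sub>M univ_completion N"
proof (rule measurableI)
  show "f x \<in> space (univ_completion N)" if "x \<in> space (univ_completion M)" for x
    using measurable_space[OF f that] by simp
  fix A assume A: "A \<in> sets (univ_completion N)"
  have "f -` A \<inter> space M \<in> sets (completion \<nu>)" if \<nu>: "finite_measure \<nu>" "sets \<nu> = sets M" for \<nu>
  proof -
    have fc: "f \<in> completion \<nu> \<rightarrow>\<^sub>M N" by (rule univ_completion_measurable_completion[OF f \<nu>])
    have sp: "space (completion \<nu>) = space M" using sets_eq_imp_space_eq[OF \<nu>(2)] by simp
    let ?d = "distr (completion \<nu>) N f"
    have "finite_measure (completion \<nu>)"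
      using finite_measure.emeasure_finite[OF \<nu>(1), of "space \<nu>"] by (intro finite_measureI) simp
    then have "finite_measure ?d" by (rule finite_measure.finite_measure_distr[OF _ fc])
    then have "A \<in> sets (completion ?d)" using A by (auto simp: sets_univ_completion)
    then obtain S Z Z' where S: "A = S \<union> Z" "Z \<subseteq> Z'" "Z' \<in> null_sets ?d" "S \<in> sets ?d"
      by (rule sets_completionE)
    have "f -` Z' \<inter> space (completion \<nu>) \<in> null_sets (completion \<nu>)"
      using S(3) fc by (auto simp: null_sets_distr_iff)
    then have "f -` Z \<inter> space (completion \<nu>) \<in> null_sets (completion \<nu>)"
      using S(2) by (rule_tac null_sets_completion_subset) auto
    moreover have "f -` S \<inter> space (completion \<nu>) \<in> sets (completion \<nu>)"
      using measurable_sets[OF fc] S(4) by simp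
    ultimately have "(f -` S \<inter> space M) \<union> (f -` Z \<inter> space M) \<in> sets (completion \<nu>)"
      unfolding sp by auto
    also have "(f -` S \<inter> space M) \<union> (f -` Z \<inter> space M) = f -` A \<inter> space M" using S(1) by auto
    finally show ?thesis .
  qed
  then show "f -` A \<inter> space (univ_completion M) \<in> sets (univ_completion M)"
    by (auto simp: sets_univ_completion[of M])
qed

section \<open>The Souslin operation and projections\<close>

text \<open>
  A Souslin scheme is usually indexed by finite sequences; here \<open>P n \<rho>\<close> takes an infinite sequence
  and may only look at its first \<open>n\<close> entries, which makes reindexing a matter of composition.
\<close>

definition souslin_scheme :: "'a measure \<Rightarrow> (nat \<Rightarrow> (nat \<Rightarrow> nat) \<Rightarrow> 'a set) \<Rightarrow> bool" where
  "souslin_scheme M P \<longleftrightarrow>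
     (\<forall>n \<rho> \<rho>'. (\<forall>i<n. \<rho> i = \<rho>' i) \<longrightarrow> P n \<rho> = P n \<rho>') \<and> (\<forall>n \<rho>. P n \<rho> \<in> sets M)"

lemma bounded_branch:
  fixes r :: "nat \<Rightarrow> nat \<Rightarrow> nat"
  assumes r: "\<And>l i. r l i \<le> k i"
  shows "\<exists>\<rho>. \<forall>j. infinite {l. \<forall>i<j. r l i = \<rho> i}"
proof -
  have "\<exists>L. \<forall>n. infinite (L n :: nat set) \<and> (L (Suc n) \<subseteq> L n \<and> (\<exists>v. \<forall>l\<in>L (Suc n). r l n = v))"
  proof (rule dependent_nat_choice)
    show "\<exists>L::nat set. infinite L" by (rule exI[of _ UNIV]) simp
    fix L :: "nat set" and n assume "infinite L"
    moreover have "finite ((\<lambda>l. r l n) ` L)"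
      by (rule finite_subset[of _ "{..k n}"]) (use r in auto)
    ultimately obtain l0 where "infinite {l \<in> L. r l n = r l0 n}"
      using pigeonhole_infinite by blast
    then show "\<exists>L'. infinite L' \<and> L' \<subseteq> L \<and> (\<exists>v. \<forall>l\<in>L'. r l n = v)"
      by (rule_tac exI[of _ "{l \<in> L. r l n = r l0 n}"]) auto
  qed
  then obtain L where L: "\<And>n. infinite (L n :: nat set)" "\<And>n. L (Suc n) \<subseteq> L n"
    "\<And>n. \<exists>v. \<forall>l\<in>L (Suc n). r l n = v" by blast
  from L(3) obtain \<rho> where \<rho>: "\<And>n l. l \<in> L (Suc n) \<Longrightarrow> r l n = \<rho> n" by metis
  have "L j \<subseteq> {l. \<forall>i<j. r l i = \<rho> i}" for j
  proof (induction j)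
    case (Suc j)
    then show ?case using L(2)[of j] \<rho>[of _ j] by (auto simp: less_Suc_eq)
  qed simp
  then show ?thesis using L(1) infinite_super by metis
qed

text \<open>
  Bounding the first coordinates one after the other by \<open>k 0\<close>, \<open>k 1\<close>, ... costs arbitrarily little
  outer measure, because outer measure is continuous along increasing unions. Once all coordinates
  are bounded, only finitely many prefixes of each length remain, and by compactness the Souslin
  operation turns into a countable intersection of measurable sets.
\<close>

lemma souslin_inner_approx:
  assumes P: "souslin_scheme M P" and \<nu>: "finite_measure \<nu>" "sets \<nu> = sets M"
    and A: "A = {x \<in> space M. \<exists>\<rho>. \<forall>n. x \<in> P n \<rho>}"
    and \<alpha>: "\<alpha> < outer_measure_of \<nu> A"
  shows "\<exists>F\<in>sets M. F \<subseteq> A \<and> \<alpha> \<le> emeasure \<nu> F"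
proof -
  have pre: "P n \<rho> = P n \<rho>'" if "\<And>i. i < n \<Longrightarrow> \<rho> i = \<rho>' i" for n \<rho> \<rho>'
    using P that unfolding souslin_scheme_def by blast
  have meas: "P n \<rho> \<in> sets M" for n \<rho> using P by (auto simp: souslin_scheme_def)
  have sp: "space \<nu> = space M" by (rule sets_eq_imp_space_eq[OF \<nu>(2)])
  define S where "S j k = {x \<in> space M. \<exists>\<rho>. (\<forall>i<j. \<rho> i \<le> k i) \<and> (\<forall>n. x \<in> P n \<rho>)}"
    for j :: nat and k :: "nat \<Rightarrow> nat"
  have S_cong: "S j k = S j k'" if "\<And>i. i < j \<Longrightarrow> k i = k' i" for j k k'
    using that unfolding S_def by auto
  have "\<exists>\<kappa>. \<forall>j. \<alpha> < outer_measure_of \<nu> (S j (\<kappa> j)) \<and> (\<forall>i<j. \<kappa> (Suc j) i = \<kappa> j i)"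
  proof (rule dependent_nat_choice)
    show "\<exists>k. \<alpha> < outer_measure_of \<nu> (S 0 k)" using \<alpha> by (simp add: S_def A)
    fix k j assume less: "\<alpha> < outer_measure_of \<nu> (S j k)"
    define T where "T m = S (Suc j) (k(j := m))" for m
    have "S j k = (\<Union>m. T m)"
      unfolding T_def S_def by (auto simp: less_Suc_eq)
    moreover have "incseq T"
    proof (rule incseq_SucI)
      fix m show "T m \<le> T (Suc m)"
      proof
        fix x assume "x \<in> T m"
        then obtain \<rho> where "x \<in> space M" "\<And>i. i < Suc j \<Longrightarrow> \<rho> i \<le> (k(j := m)) i" "\<And>n. x \<in> P n \<rho>"
          by (auto simp: T_def S_def)
        moreover from this(2)[of j] have "\<rho> i \<le> (k(j := Suc m)) i" if "i < Suc j" for i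
          using calculation(2)[OF that] by (cases "i = j") auto
        ultimately show "x \<in> T (Suc m)" unfolding T_def S_def by blast
      qed
    qed
    moreover have "T m \<subseteq> space \<nu>" for m by (auto simp: T_def S_def sp)
    ultimately have "outer_measure_of \<nu> (S j k) = (SUP m. outer_measure_of \<nu> (T m))"
      by (simp add: SUP_outer_measure_of_incseq)
    then obtain m where "\<alpha> < outer_measure_of \<nu> (T m)" using less by (auto simp: less_SUP_iff)
    then show "\<exists>k'. \<alpha> < outer_measure_of \<nu> (S (Suc j) k') \<and> (\<forall>i<j. k' i = k i)"
      unfolding T_def by (intro exI[of _ "k(j := m)"]) auto
  qed
  then obtain \<kappa> where \<kappa>: "\<And>j. \<alpha> < outer_measure_of \<nu> (S j (\<kappa> j))"
    "\<And>i j. i < j \<Longrightarrow> \<kappa> (Suc j) i = \<kappa> j i" by metis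
  define k where "k i = \<kappa> (Suc i) i" for i
  have "i < j \<Longrightarrow> \<kappa> j i = k i" for i j
  proof (induction j)
    case (Suc j)
    then show ?case by (cases "i = j") (auto simp: k_def \<kappa>(2))
  qed simp
  then have S_k: "\<alpha> < outer_measure_of \<nu> (S j k)" for j
    using \<kappa>(1)[of j] S_cong[of j "\<kappa> j" k] by auto
  define R where "R j = {\<rho>. (\<forall>i<j. \<rho> i \<le> k i) \<and> (\<forall>i\<ge>j. \<rho> i = 0)}" for j :: nat
  define Q where "Q j = (\<Union>\<rho>\<in>R j. space M \<inter> (\<Inter>n\<in>{..j}. P n \<rho>))" for j
  have finR: "finite (R j)" for j
  proof -
    let ?K = "Max (k ` {..<Suc j})"
    have "k i \<le> ?K" if "i < j" for i using that by (intro Max_ge) auto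
    then have "R j \<subseteq> {\<rho>. \<forall>i. (i \<in> {..<j} \<longrightarrow> \<rho> i \<in> {..?K}) \<and> (i \<notin> {..<j} \<longrightarrow> \<rho> i = 0)}"
      unfolding R_def by (force intro: order_trans)
    then show ?thesis by (rule finite_subset) (intro finite_set_of_finite_funs, simp_all)
  qed
  have Qm: "Q j \<in> sets M" for j
    unfolding Q_def using finR by (intro sets.finite_UN sets.Int sets.finite_INT) (auto simp: meas)
  have SQ: "S j k \<subseteq> Q j" for j
  proof
    fix x assume "x \<in> S j k"
    then obtain \<rho> where x: "x \<in> space M" "\<And>i. i < j \<Longrightarrow> \<rho> i \<le> k i" "\<And>n. x \<in> P n \<rho>" by (auto simp: S_def)
    define \<rho>' where "\<rho>' i = (if i < j then \<rho> i else 0)" for i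
    have "\<rho>' \<in> R j" using x(2) by (auto simp: R_def \<rho>'_def)
    moreover have "P n \<rho>' = P n \<rho>" if "n \<le> j" for n by (rule pre) (use that in \<open>auto simp: \<rho>'_def\<close>)
    ultimately show "x \<in> Q j" unfolding Q_def using x by (auto intro!: bexI[of _ \<rho>'])
  qed
  have Qdec: "Q (Suc j) \<subseteq> Q j" for j
  proof
    fix x assume "x \<in> Q (Suc j)"
    then obtain \<rho> where x: "x \<in> space M" "\<rho> \<in> R (Suc j)" "\<And>n. n \<le> Suc j \<Longrightarrow> x \<in> P n \<rho>" by (auto simp: Q_def)
    define \<rho>' where "\<rho>' i = (if i < j then \<rho> i else 0)" for i
    have "\<rho>' \<in> R j" using x(2) by (auto simp: R_def \<rho>'_def)
    moreover have "P n \<rho>' = P n \<rho>" if "n \<le> j" for n by (rule pre) (use that in \<open>auto simp: \<rho>'_def\<close>)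
    ultimately show "x \<in> Q j" unfolding Q_def using x by (auto intro!: bexI[of _ \<rho>'])
  qed
  have \<alpha>Q: "\<alpha> \<le> emeasure \<nu> (Q j)" for j
    using S_k[of j] outer_measure_of_mono[OF SQ[of j], of \<nu>] Qm[of j] \<nu>(2) by auto
  have "(\<Inter>j. Q j) \<subseteq> A"
  proof
    fix x assume "x \<in> (\<Inter>j. Q j)"
    then have xQ: "x \<in> Q j" for j by blast
    then have x: "x \<in> space M" by (auto simp: Q_def)
    have "\<exists>\<rho>\<in>R j. \<forall>n\<le>j. x \<in> P n \<rho>" for j
      using xQ[of j] by (auto simp: Q_def)
    then obtain r where r: "\<And>j. r j \<in> R j" "\<And>j n. n \<le> j \<Longrightarrow> x \<in> P n (r j)" by metis
    have "r l i \<le> k i" for l i using r(1)[of l] by (cases "i < l") (auto simp: R_def)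
    then obtain \<rho> where \<rho>: "\<And>j. infinite {l. \<forall>i<j. r l i = \<rho> i}" using bounded_branch by metis
    have "x \<in> P n \<rho>" for n
    proof -
      obtain l where l: "l \<ge> n" "\<forall>i<n. r l i = \<rho> i"
        using \<rho>[of n] unfolding infinite_nat_iff_unbounded_le by auto
      then have "P n (r l) = P n \<rho>" by (intro pre) auto
      then show ?thesis using r(2)[OF l(1)] by simp
    qed
    then show "x \<in> A" using x by (auto simp: A)
  qed
  moreover have "(\<lambda>j. emeasure \<nu> (Q j)) \<longlonglongrightarrow> emeasure \<nu> (\<Inter>j. Q j)"
    using Qm \<nu> Qdec by (intro Lim_emeasure_decseq decseq_SucI) (auto simp: finite_measure.emeasure_finite)
  then have "\<alpha> \<le> emeasure \<nu> (\<Inter>j. Q j)"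
    using \<alpha>Q by (intro LIMSEQ_le_const) auto
  moreover have "(\<Inter>j. Q j) \<in> sets M" using Qm by auto
  ultimately show ?thesis by blast
qed

theorem souslin_univ_measurable:
  assumes P: "souslin_scheme M P"
  shows "{x \<in> space M. \<exists>\<rho>. \<forall>n. x \<in> P n \<rho>} \<in> sets (univ_completion M)"
proof -
  define A where "A = {x \<in> space M. \<exists>\<rho>. \<forall>n. x \<in> P n \<rho>}"
  have "A \<in> sets (completion \<nu>)" if \<nu>: "finite_measure \<nu>" "sets \<nu> = sets M" for \<nu>
  proof -
    interpret finite_measure \<nu> by fact
    have "A \<subseteq> space \<nu>" using sets_eq_imp_space_eq[OF \<nu>(2)] by (auto simp: A_def)
    then obtain E where E: "E \<in> sets \<nu>" "A \<subseteq> E" "outer_measure_of \<nu> A = emeasure \<nu> E"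
      using outer_measure_of_attain[of A \<nu>] by blast
    have "\<exists>F\<in>sets \<nu>. F \<subseteq> A \<and> measure \<nu> E - \<epsilon> \<le> measure \<nu> F" if "\<epsilon> > 0" for \<epsilon>
    proof (cases "measure \<nu> E - \<epsilon> \<ge> 0")
      case True
      have "ennreal (measure \<nu> E - \<epsilon>) < outer_measure_of \<nu> A"
        unfolding E(3) using that True by (simp add: emeasure_eq_measure ennreal_less_iff)
      from souslin_inner_approx[OF P \<nu> A_def this] obtain F where
        "F \<in> sets M" "F \<subseteq> A" "ennreal (measure \<nu> E - \<epsilon>) \<le> emeasure \<nu> F" by blast
      then show ?thesis using \<nu>(2) by (intro bexI[of _ F]) (auto simp: emeasure_eq_measure)
    next
      case False
      then show ?thesis by (intro bexI[of _ "{}"]) auto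
    qed
    then have "\<exists>F. \<forall>n. F n \<in> sets \<nu> \<and> F n \<subseteq> A \<and> measure \<nu> E - 1 / real (Suc n) \<le> measure \<nu> (F n)"
      by (intro choice) (simp add: Bex_def)
    then obtain F where F: "\<And>n. F n \<in> sets \<nu>" "\<And>n. F n \<subseteq> A"
      "\<And>n. measure \<nu> E - 1 / real (Suc n) \<le> measure \<nu> (F n)" by auto
    let ?G = "\<Union>n. F n"
    have G: "?G \<in> sets \<nu>" "?G \<subseteq> A" using F(1,2) by auto
    have "measure \<nu> E - 1 / real (Suc n) \<le> measure \<nu> ?G" for n
      using F(3)[of n] finite_measure_mono[of "F n" ?G] G(1) by fastforce
    then have le: "measure \<nu> E \<le> measure \<nu> ?G + 1 / real (Suc n)" for n by (simp add: diff_le_eq)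
    have "(\<lambda>n. measure \<nu> ?G + 1 / real (Suc n)) \<longlonglongrightarrow> measure \<nu> ?G + 0"
      using LIMSEQ_inverse_real_of_nat by (intro tendsto_intros) (simp add: inverse_eq_divide)
    then have "measure \<nu> E \<le> measure \<nu> ?G + 0"
      by (rule LIMSEQ_le_const) (use le in blast)
    moreover have "measure \<nu> (E - ?G) = measure \<nu> E - measure \<nu> ?G"
      using G E by (intro finite_measure_Diff) auto
    ultimately have "measure \<nu> (E - ?G) = 0" using measure_nonneg[of \<nu> "E - ?G"] by linarith
    then have "E - ?G \<in> null_sets \<nu>" using E G by (auto simp: null_sets_def emeasure_eq_measure)
    then show ?thesis using G E by (intro sets_completionI[of _ ?G "A - ?G" "E - ?G"]) auto
  qed
  then show ?thesis unfolding A_def by (auto simp: sets_univ_completion)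
qed

abbreviation baire :: "(nat \<Rightarrow> nat) measure" where
  "baire \<equiv> \<Pi>\<^sub>M _\<in>UNIV. count_space UNIV"

definition zip_seq :: "(nat \<Rightarrow> nat) \<Rightarrow> (nat \<Rightarrow> nat) \<Rightarrow> nat \<Rightarrow> nat" where
  "zip_seq \<sigma> \<tau> i = prod_encode (\<sigma> i, \<tau> i)"

definition seq_fst :: "(nat \<Rightarrow> nat) \<Rightarrow> nat \<Rightarrow> nat" where
  "seq_fst \<rho> i = fst (prod_decode (\<rho> i))"

definition seq_snd :: "(nat \<Rightarrow> nat) \<Rightarrow> nat \<Rightarrow> nat" where
  "seq_snd \<rho> i = snd (prod_decode (\<rho> i))"

lemma seq_zip [simp]:
  "seq_fst (zip_seq \<sigma> \<tau>) = \<sigma>" "seq_snd (zip_seq \<sigma> \<tau>) = \<tau>" "zip_seq (seq_fst \<rho>) (seq_snd \<rho>) = \<rho>"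
  by (auto simp: zip_seq_def seq_fst_def seq_snd_def fun_eq_iff)

text \<open>
  Souslin sets of the product with the Baire space: the first half of the branch is the point of the
  Baire space, only the second half is quantified. Projecting such a set to the first factor quantifies
  the first half as well, and so is a Souslin operation over \<open>M\<close>.
\<close>

definition souslin_rel :: "'a measure \<Rightarrow> ('a \<times> (nat \<Rightarrow> nat)) set \<Rightarrow> bool" where
  "souslin_rel M R \<longleftrightarrow> (\<exists>P. souslin_scheme M P \<and>
     R = {(x, \<sigma>). x \<in> space M \<and> (\<exists>\<tau>. \<forall>n. x \<in> P n (zip_seq \<sigma> \<tau>))})"

lemma souslin_schemeI:
  assumes "\<And>n \<rho> \<rho>'. (\<And>i. i < n \<Longrightarrow> \<rho> i = \<rho>' i) \<Longrightarrow> P n \<rho> = P n \<rho>'" "\<And>n \<rho>. P n \<rho> \<in> sets M"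
  shows "souslin_scheme M P"
  unfolding souslin_scheme_def by (intro conjI allI impI assms(2)) (rule assms(1), blast)

lemma souslin_schemeD:
  assumes "souslin_scheme M P"
  shows "(\<And>i. i < n \<Longrightarrow> \<rho> i = \<rho>' i) \<Longrightarrow> P n \<rho> = P n \<rho>'" "P n \<rho> \<in> sets M"
  using assms unfolding souslin_scheme_def by blast+

lemma souslin_rel_UN:
  assumes "\<And>i::nat. souslin_rel M (R i)"
  shows "souslin_rel M (\<Union>i. R i)"
proof -
  have "\<exists>P. \<forall>i. souslin_scheme M (P i) \<and>
      R i = {(x, \<sigma>). x \<in> space M \<and> (\<exists>\<tau>. \<forall>n. x \<in> P i n (zip_seq \<sigma> \<tau>))}"
    using assms unfolding souslin_rel_def by (intro choice) simp
  then obtain P where P: "\<And>i. souslin_scheme M (P i)"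
    "\<And>i. R i = {(x, \<sigma>). x \<in> space M \<and> (\<exists>\<tau>. \<forall>n. x \<in> P i n (zip_seq \<sigma> \<tau>))}"
    by blast
  define sh where "sh \<rho> = zip_seq (seq_fst \<rho>) (\<lambda>k. seq_snd \<rho> (Suc k))" for \<rho>
  (* the first entry of the quantified half says which of the sets the point belongs to *)
  define P' where "P' n \<rho> = (case n of 0 \<Rightarrow> space M | Suc m \<Rightarrow> P (seq_snd \<rho> 0) m (sh \<rho>))" for n \<rho>
  have "souslin_scheme M P'"
  proof (rule souslin_schemeI)
    fix n :: nat and \<rho> \<rho>' assume eq: "\<And>i. i < n \<Longrightarrow> \<rho> i = (\<rho>' i :: nat)"
    show "P' n \<rho> = P' n \<rho>'"
    proof (cases n)
      case (Suc m)
      have "seq_snd \<rho> 0 = seq_snd \<rho>' 0" using eq[of 0] Suc by (simp add: seq_snd_def)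
      moreover have "P i m (sh \<rho>) = P i m (sh \<rho>')" for i
        by (rule souslin_schemeD(1)[OF P(1)])
          (use eq Suc in \<open>auto simp: sh_def zip_seq_def seq_fst_def seq_snd_def\<close>)
      ultimately show ?thesis by (simp add: P'_def Suc)
    qed (simp add: P'_def)
  next
    show "P' n \<rho> \<in> sets M" for n \<rho>
      using souslin_schemeD(2)[OF P(1)] by (auto simp: P'_def split: nat.split)
  qed
  moreover have "(\<Union>i. R i) = {(x, \<sigma>). x \<in> space M \<and> (\<exists>\<tau>. \<forall>n. x \<in> P' n (zip_seq \<sigma> \<tau>))}"
  proof -
    have eq: "(\<exists>i \<tau>. \<forall>n. x \<in> P i n (zip_seq \<sigma> \<tau>)) \<longleftrightarrow> (\<exists>\<tau>. \<forall>n. x \<in> P' n (zip_seq \<sigma> \<tau>))"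
      if x: "x \<in> space M" for x \<sigma>
    proof
      assume "\<exists>i \<tau>. \<forall>n. x \<in> P i n (zip_seq \<sigma> \<tau>)"
      then obtain i \<tau> where *: "\<And>n. x \<in> P i n (zip_seq \<sigma> \<tau>)" by blast
      have "x \<in> P' n (zip_seq \<sigma> (case_nat i \<tau>))" for n
        using * x by (cases n) (auto simp: P'_def sh_def)
      then show "\<exists>\<tau>. \<forall>n. x \<in> P' n (zip_seq \<sigma> \<tau>)" by blast
    next
      assume "\<exists>\<tau>. \<forall>n. x \<in> P' n (zip_seq \<sigma> \<tau>)"
      then obtain \<tau> where *: "\<And>n. x \<in> P' n (zip_seq \<sigma> \<tau>)" by blast
      have "x \<in> P (\<tau> 0) n (zip_seq \<sigma> (\<lambda>k. \<tau> (Suc k)))" for n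
        using *[of "Suc n"] by (simp add: P'_def sh_def)
      then show "\<exists>i \<tau>. \<forall>n. x \<in> P i n (zip_seq \<sigma> \<tau>)" by blast
    qed
    show ?thesis
    proof (rule set_eqI)
      fix p show "p \<in> (\<Union>i. R i) \<longleftrightarrow> p \<in> {(x, \<sigma>). x \<in> space M \<and> (\<exists>\<tau>. \<forall>n. x \<in> P' n (zip_seq \<sigma> \<tau>))}"
        by (cases p; cases "fst p \<in> space M") (simp_all add: P(2) eq)
    qed
  qed
  ultimately show ?thesis unfolding souslin_rel_def by blast
qed

lemma souslin_rel_INT:
  assumes "\<And>i::nat. souslin_rel M (R i)"
  shows "souslin_rel M (\<Inter>i. R i)"
proof -
  have "\<exists>P. \<forall>i. souslin_scheme M (P i) \<and>
      R i = {(x, \<sigma>). x \<in> space M \<and> (\<exists>\<tau>. \<forall>n. x \<in> P i n (zip_seq \<sigma> \<tau>))}"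
    using assms unfolding souslin_rel_def by (intro choice) simp
  then obtain P where P: "\<And>i. souslin_scheme M (P i)"
    "\<And>i. R i = {(x, \<sigma>). x \<in> space M \<and> (\<exists>\<tau>. \<forall>n. x \<in> P i n (zip_seq \<sigma> \<tau>))}"
    by blast
  define sh where "sh i \<rho> = zip_seq (seq_fst \<rho>) (\<lambda>k. seq_snd \<rho> (prod_encode (i, k)))" for i \<rho>
  (* one sequence carries a branch for every i; level n uses the conditions that its first n entries decide *)
  define I where "I n = {(i, m). i \<le> n \<and> m \<le> n \<and> (\<forall>k<m. prod_encode (i, k) < n)}" for n :: nat
  have I_sub: "I n \<subseteq> {..n} \<times> {..n}" for n by (auto simp: I_def)
  define P' where "P' n \<rho> = space M \<inter> (\<Inter>(i, m)\<in>I n. P i m (sh i \<rho>))" for n \<rho>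
  have "souslin_scheme M P'"
  proof (rule souslin_schemeI)
    fix n :: nat and \<rho> \<rho>' assume eq: "\<And>i. i < n \<Longrightarrow> \<rho> i = (\<rho>' i :: nat)"
    have "P i m (sh i \<rho>) = P i m (sh i \<rho>')" if "(i, m) \<in> I n" for i m
      by (rule souslin_schemeD(1)[OF P(1)])
        (use eq that in \<open>auto simp: I_def sh_def zip_seq_def seq_fst_def seq_snd_def\<close>)
    then show "P' n \<rho> = P' n \<rho>'" by (auto simp: P'_def)
  next
    fix n \<rho>
    have "finite (I n)" using I_sub by (rule finite_subset) simp
    moreover have "(\<lambda>(i, m). P i m (sh i \<rho>)) p \<in> sets M" for p
      using souslin_schemeD(2)[OF P(1)] by (cases p) auto
    moreover have "P' n \<rho> = (if I n = {} then space M else space M \<inter> (\<Inter>p\<in>I n. (\<lambda>(i, m). P i m (sh i \<rho>)) p))"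
      by (simp add: P'_def)
    ultimately show "P' n \<rho> \<in> sets M" by (auto intro!: sets.Int sets.finite_INT simp del: case_prod_conv)
  qed
  moreover have "(\<Inter>i. R i) = {(x, \<sigma>). x \<in> space M \<and> (\<exists>\<tau>. \<forall>n. x \<in> P' n (zip_seq \<sigma> \<tau>))}"
  proof -
    have eq: "(\<forall>i. \<exists>\<tau>. \<forall>n. x \<in> P i n (zip_seq \<sigma> \<tau>)) \<longleftrightarrow> (\<exists>\<tau>. \<forall>n. x \<in> P' n (zip_seq \<sigma> \<tau>))"
      if x: "x \<in> space M" for x \<sigma>
    proof
      assume "\<forall>i. \<exists>\<tau>. \<forall>n. x \<in> P i n (zip_seq \<sigma> \<tau>)"
      then obtain t where *: "\<And>i n. x \<in> P i n (zip_seq \<sigma> (t i))" by metis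
      have "x \<in> P' n (zip_seq \<sigma> (\<lambda>j. t (fst (prod_decode j)) (snd (prod_decode j))))" for n
        using * x by (auto simp: P'_def sh_def)
      then show "\<exists>\<tau>. \<forall>n. x \<in> P' n (zip_seq \<sigma> \<tau>)" by blast
    next
      assume "\<exists>\<tau>. \<forall>n. x \<in> P' n (zip_seq \<sigma> \<tau>)"
      then obtain \<tau> where *: "\<And>n. x \<in> P' n (zip_seq \<sigma> \<tau>)" by blast
      have "x \<in> P i m (zip_seq \<sigma> (\<lambda>k. \<tau> (prod_encode (i, k))))" for i m
      proof -
        define n where "n = i + m + (\<Sum>k<m. Suc (prod_encode (i, k)))"
        have "prod_encode (i, k) < n" if "k < m" for k
        proof -
          have "Suc (prod_encode (i, k)) \<le> (\<Sum>k<m. Suc (prod_encode (i, k)))"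
            using that by (intro member_le_sum) auto
          then show ?thesis by (simp add: n_def)
        qed
        then have "(i, m) \<in> I n" by (simp add: I_def n_def)
        then show ?thesis using *[of n] by (auto simp: P'_def sh_def)
      qed
      then show "\<forall>i. \<exists>\<tau>. \<forall>n. x \<in> P i n (zip_seq \<sigma> \<tau>)" by blast
    qed
    show ?thesis
    proof (rule set_eqI)
      fix p show "p \<in> (\<Inter>i. R i) \<longleftrightarrow> p \<in> {(x, \<sigma>). x \<in> space M \<and> (\<exists>\<tau>. \<forall>n. x \<in> P' n (zip_seq \<sigma> \<tau>))}"
        by (cases p; cases "fst p \<in> space M") (simp_all add: P(2) eq)
    qed
  qed
  ultimately show ?thesis unfolding souslin_rel_def by blast
qed

lemma souslin_rel_coordinate:
  assumes "A \<in> sets M"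
  shows "souslin_rel M {(x, \<sigma>). x \<in> A \<and> \<sigma> k \<in> V}"
  unfolding souslin_rel_def
proof (intro exI conjI)
  let ?P = "\<lambda>n \<rho>. if k < n \<and> seq_fst \<rho> k \<notin> V then {} else A"
  show "souslin_scheme M ?P"
    by (rule souslin_schemeI) (use assms in \<open>auto simp: seq_fst_def\<close>)
  show "{(x, \<sigma>). x \<in> A \<and> \<sigma> k \<in> V} =
      {(x, \<sigma>). x \<in> space M \<and> (\<exists>\<tau>. \<forall>n. x \<in> ?P n (zip_seq \<sigma> \<tau>))}"
    using sets.sets_into_space[OF assms] by (auto split: if_splits)
qed

text \<open>
  Souslin sets are closed under countable unions and intersections but not under complements; the
  Borel sets are reached through the sets which are Souslin together with their complement.
\<close>

lemma souslin_rel_pair_measure: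
  assumes R: "R \<in> sets (M \<Otimes>\<^sub>M baire)"
  shows "souslin_rel M R"
proof -
  define \<Omega> where "\<Omega> = space M \<times> (UNIV :: (nat \<Rightarrow> nat) set)"
  define \<D> where "\<D> = {R. R \<subseteq> \<Omega> \<and> souslin_rel M R \<and> souslin_rel M (\<Omega> - R)}"
  have "\<Omega> = {(x, \<sigma>). x \<in> space M \<and> \<sigma> 0 \<in> UNIV}" by (auto simp: \<Omega>_def)
  then have top: "souslin_rel M \<Omega>" and bot: "souslin_rel M {}"
    using souslin_rel_coordinate[of "space M" M 0 UNIV] souslin_rel_coordinate[of "{}" M 0 UNIV]
    by simp_all
  have "sigma_algebra \<Omega> \<D>"
  proof (rule sigma_algebra_iff2[THEN iffD2], intro conjI ballI allI impI)
    fix A assume "A \<in> \<D>"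
    then show "\<Omega> - A \<in> \<D>" by (auto simp: \<D>_def double_diff)
  next
    fix A :: "nat \<Rightarrow> _" assume A: "range A \<subseteq> \<D>"
    have "\<Omega> - (\<Union>i. A i) = (\<Inter>i. \<Omega> - A i)" by auto
    then show "(\<Union>i. A i) \<in> \<D>"
      using A souslin_rel_UN[of M A] souslin_rel_INT[of M "\<lambda>i. \<Omega> - A i"] by (auto simp: \<D>_def)
  qed (use top bot in \<open>auto simp: \<D>_def\<close>)
  then have sets_D: "sets (sigma \<Omega> \<D>) = \<D>" by (rule sigma_algebra.sets_measure_of_eq)
  have space_D: "space (sigma \<Omega> \<D>) = \<Omega>" by (rule space_measure_of) (auto simp: \<D>_def)
  have gen: "{(x, \<sigma>). x \<in> A \<and> \<sigma> k \<in> V} \<in> \<D>" if "A = space M \<or> V = UNIV" "A \<in> sets M" for A k V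
  proof -
    have "\<Omega> - {(x, \<sigma>). x \<in> A \<and> \<sigma> k \<in> V} =
        (if V = UNIV then {(x, \<sigma>). x \<in> space M - A \<and> \<sigma> k \<in> UNIV} else {(x, \<sigma>). x \<in> space M \<and> \<sigma> k \<in> - V})"
      using that by (auto simp: \<Omega>_def)
    moreover have "souslin_rel M \<dots>"
      using that souslin_rel_coordinate[of "space M - A" M k UNIV]
        souslin_rel_coordinate[of "space M" M k "- V"] by auto
    ultimately show ?thesis
      using souslin_rel_coordinate[OF that(2), of k V] sets.sets_into_space[OF that(2)]
      by (auto simp: \<D>_def \<Omega>_def)
  qed
  have "(\<lambda>p. p) \<in> sigma \<Omega> \<D> \<rightarrow>\<^sub>M M \<Otimes>\<^sub>M baire"
  proof (rule measurable_pair)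
    have "fst \<in> sigma \<Omega> \<D> \<rightarrow>\<^sub>M M"
    proof (rule measurableI)
      fix A assume A: "A \<in> sets M"
      have "fst -` A \<inter> \<Omega> = {(x, \<sigma>). x \<in> A \<and> \<sigma> 0 \<in> UNIV}"
        using sets.sets_into_space[OF A] by (auto simp: \<Omega>_def)
      then show "fst -` A \<inter> space (sigma \<Omega> \<D>) \<in> sets (sigma \<Omega> \<D>)"
        using gen[of A UNIV 0] A by (simp add: space_D sets_D)
    qed (simp add: space_D, simp add: \<Omega>_def mem_Times_iff)
    then show "fst \<circ> (\<lambda>p. p) \<in> sigma \<Omega> \<D> \<rightarrow>\<^sub>M M" by (simp add: comp_def)
    have "snd \<in> sigma \<Omega> \<D> \<rightarrow>\<^sub>M baire"
    proof (rule measurable_PiM_single')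
      fix k
      have "(\<lambda>p. snd p k) -` {m} \<inter> \<Omega> = {(x, \<sigma>). x \<in> space M \<and> \<sigma> k \<in> {m}}" for m
        by (auto simp: \<Omega>_def)
      then show "(\<lambda>p. snd p k) \<in> sigma \<Omega> \<D> \<rightarrow>\<^sub>M count_space UNIV"
        using gen[of "space M" "{_}" k] by (auto simp: measurable_count_space_eq2_countable space_D sets_D)
    qed auto
    then show "snd \<circ> (\<lambda>p. p) \<in> sigma \<Omega> \<D> \<rightarrow>\<^sub>M baire" by (simp add: comp_def)
  qed
  from measurable_sets[OF this R] have "R \<inter> \<Omega> \<in> \<D>" by (simp add: space_D sets_D)
  moreover have "R \<subseteq> \<Omega>" using sets.sets_into_space[OF R] by (auto simp: space_pair_measure \<Omega>_def)
  ultimately show ?thesis by (simp add: \<D>_def Int_absorb2)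
qed

lemma projection_baire_univ_measurable:
  assumes "R \<in> sets (M \<Otimes>\<^sub>M baire)"
  shows "{x \<in> space M. \<exists>\<sigma>. (x, \<sigma>) \<in> R} \<in> sets (univ_completion M)"
proof -
  obtain P where P: "souslin_scheme M P"
    "R = {(x, \<sigma>). x \<in> space M \<and> (\<exists>\<tau>. \<forall>n. x \<in> P n (zip_seq \<sigma> \<tau>))}"
    using souslin_rel_pair_measure[OF assms] unfolding souslin_rel_def by blast
  have "(\<exists>\<sigma> \<tau>. \<forall>n. x \<in> P n (zip_seq \<sigma> \<tau>)) \<longleftrightarrow> (\<exists>\<rho>. \<forall>n. x \<in> P n \<rho>)" for x
    by (metis seq_zip(3))
  then have "{x \<in> space M. \<exists>\<sigma>. (x, \<sigma>) \<in> R} = {x \<in> space M. \<exists>\<rho>. \<forall>n. x \<in> P n \<rho>}"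
    unfolding P(2) by auto
  with souslin_univ_measurable[OF P(1)] show ?thesis by simp
qed

text \<open>
  A point of a Polish space is coded by a sequence of indices into a countable dense set which
  converges to it at a prescribed rate.
\<close>

lemma baire_surjection:
  assumes X: "standard_borel X" and ne: "space X \<noteq> {}"
  shows "\<exists>g. g \<in> baire \<rightarrow>\<^sub>M X \<and> range g = space X"
proof -
  obtain T where T: "completely_metrizable_space T" "second_countable T" "topspace T = space X"
      "sets X = sigma_sets (topspace T) {U. openin T U}"
    using X by (auto simp: standard_borel_def)
  then obtain S d where Sd: "Metric_space S d" "Metric_space.mcomplete S d" "T = Metric_space.mtopology S d"
    by (auto simp: completely_metrizable_space_def)
  interpret Metric_space S d by fact
  have S: "S = space X" using T(3) Sd(3) by simp
  obtain C where C: "countable C" "C \<subseteq> S" "mtopology closure_of C = S"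
    using second_countable_imp_separable_space[OF T(2)] by (auto simp: separable_space_def Sd(3))
  have "C \<noteq> {}" using C(3) S ne by auto
  define x where "x = from_nat_into C"
  have x: "x n \<in> S" for n using C(2) \<open>C \<noteq> {}\<close> from_nat_into[of C n] by (auto simp: x_def)
  have dense: "\<exists>n. d (x n) y < \<epsilon>" if "y \<in> S" "\<epsilon> > 0" for y \<epsilon>
  proof -
    have "y \<in> mtopology closure_of C" using that C(3) by simp
    then have "\<exists>c\<in>C. c \<in> mball y \<epsilon>" using \<open>\<epsilon> > 0\<close> by (simp add: metric_closure_of)
    then obtain c where "c \<in> C" "d y c < \<epsilon>" by auto
    moreover obtain n where "x n = c"
      using \<open>c \<in> C\<close> C(1) \<open>C \<noteq> {}\<close> unfolding x_def by (metis from_nat_into_surj)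
    ultimately show ?thesis using commute by auto
  qed
  (* the Cauchy condition with a fixed modulus is a measurable condition on the codes *)
  define G where "G = {\<sigma>. \<forall>m n. m \<le> n \<longrightarrow> d (x (\<sigma> m)) (x (\<sigma> n)) \<le> (1/2) ^ m}"
  define g where "g \<sigma> = (if \<sigma> \<in> G then SOME y. limitin mtopology (\<lambda>n. x (\<sigma> n)) y sequentially else x 0)" for \<sigma>
  have lim: "limitin mtopology (\<lambda>n. x (\<sigma> n)) (g \<sigma>) sequentially" if "\<sigma> \<in> G" for \<sigma>
  proof -
    have "MCauchy (\<lambda>n. x (\<sigma> n))"
      unfolding MCauchy_def
    proof (intro conjI allI impI)
      fix \<epsilon> :: real assume "\<epsilon> > 0"
      then obtain N where N: "(1/2) ^ N < \<epsilon>" using real_arch_pow_inv[of \<epsilon> "1/2"] by auto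
      have "d (x (\<sigma> m)) (x (\<sigma> n)) < \<epsilon>" if "N \<le> m" "m \<le> n" for m n
      proof -
        have "(1/2::real) ^ m \<le> (1/2) ^ N" by (rule power_decreasing) (use that in auto)
        moreover have "d (x (\<sigma> m)) (x (\<sigma> n)) \<le> (1/2) ^ m" using that(2) \<open>\<sigma> \<in> G\<close> by (auto simp: G_def)
        ultimately show ?thesis using N by linarith
      qed
      then show "\<exists>N. \<forall>m n. N \<le> m \<longrightarrow> N \<le> n \<longrightarrow> d (x (\<sigma> m)) (x (\<sigma> n)) < \<epsilon>"
        by (metis commute nle_le)
    qed (use x in auto)
    then have "\<exists>y. limitin mtopology (\<lambda>n. x (\<sigma> n)) y sequentially"
      using Sd(2) by (simp add: mcomplete_def)
    then show ?thesis using that by (simp add: g_def) (rule someI_ex)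
  qed
  have gS: "g \<sigma> \<in> S" for \<sigma>
    using lim[of \<sigma>] x by (cases "\<sigma> \<in> G") (auto simp: limitin_metric, simp add: g_def)
  have [measurable]: "Measurable.pred baire (\<lambda>\<sigma>. Q (\<sigma> m) (\<sigma> n))" for Q and m n :: nat
  proof -
    have "(\<lambda>\<sigma>. Q (\<sigma> m) (\<sigma> n)) = (\<lambda>\<sigma>. \<exists>a b. Q a b \<and> \<sigma> m = a \<and> \<sigma> n = (b::nat))" by auto
    then show ?thesis by (simp only:) measurable
  qed
  have "g \<in> baire \<rightarrow>\<^sub>M sigma (topspace T) {U. openin T U}"
  proof (rule measurable_measure_of)
    show "{U. openin T U} \<subseteq> Pow (topspace T)" by (auto dest: openin_subset)
    show "g \<in> space baire \<rightarrow> topspace T" using gS S T(3) by simp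
    fix U assume "U \<in> {U. openin T U}"
    then have U: "openin mtopology U" by (simp add: Sd(3))
    have in_U: "g \<sigma> \<in> U \<longleftrightarrow> (\<exists>k N. \<forall>n\<ge>N. mball (x (\<sigma> n)) (1 / real (Suc k)) \<subseteq> U)" if \<sigma>G: "\<sigma> \<in> G" for \<sigma>
    proof
      assume "g \<sigma> \<in> U"
      then obtain r where r: "r > 0" "mball (g \<sigma>) r \<subseteq> U" using U by (auto simp: openin_mtopology)
      obtain k where k: "1 / real (Suc k) < r / 2" using reals_Archimedean[of "r/2"] r by (auto simp: inverse_eq_divide)
      obtain N where N: "\<And>n. n \<ge> N \<Longrightarrow> d (x (\<sigma> n)) (g \<sigma>) < r / 2"
        using lim[OF \<sigma>G] half_gt_zero[OF r(1)] unfolding limitin_metric eventually_sequentially by meson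
      have "mball (x (\<sigma> n)) (1 / real (Suc k)) \<subseteq> U" if "n \<ge> N" for n
      proof
        fix y assume "y \<in> mball (x (\<sigma> n)) (1 / real (Suc k))"
        then have y: "y \<in> S" "d (x (\<sigma> n)) y < r / 2" using k by auto
        have "d (g \<sigma>) y \<le> d (g \<sigma>) (x (\<sigma> n)) + d (x (\<sigma> n)) y" by (rule triangle) (use gS x y in auto)
        also have "\<dots> < r" using N[OF that] y(2) commute[of "g \<sigma>"] by simp
        finally show "y \<in> U" using r(2) y(1) gS by auto
      qed
      then show "\<exists>k N. \<forall>n\<ge>N. mball (x (\<sigma> n)) (1 / real (Suc k)) \<subseteq> U" by blast
    next
      assume "\<exists>k N. \<forall>n\<ge>N. mball (x (\<sigma> n)) (1 / real (Suc k)) \<subseteq> U"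
      then obtain k N where kN: "\<And>n. n \<ge> N \<Longrightarrow> mball (x (\<sigma> n)) (1 / real (Suc k)) \<subseteq> U" by blast
      have "0 < 1 / real (Suc k)" by simp
      then obtain N' where N': "\<And>n. n \<ge> N' \<Longrightarrow> d (x (\<sigma> n)) (g \<sigma>) < 1 / real (Suc k)"
        using lim[OF \<sigma>G] unfolding limitin_metric eventually_sequentially by meson
      then have "g \<sigma> \<in> mball (x (\<sigma> (max N N'))) (1 / real (Suc k))" using gS x by auto
      then show "g \<sigma> \<in> U" using kN[of "max N N'"] by auto
    qed
    have "Measurable.pred baire (\<lambda>\<sigma>. (\<sigma> \<in> G \<and> (\<exists>k N. \<forall>n. n \<ge> N \<longrightarrow> mball (x (\<sigma> n)) (1 / real (Suc k)) \<subseteq> U))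
        \<or> (\<sigma> \<notin> G \<and> x 0 \<in> U))"
      unfolding G_def by measurable
    also have "(\<lambda>\<sigma>. (\<sigma> \<in> G \<and> (\<exists>k N. \<forall>n. n \<ge> N \<longrightarrow> mball (x (\<sigma> n)) (1 / real (Suc k)) \<subseteq> U))
        \<or> (\<sigma> \<notin> G \<and> x 0 \<in> U)) = (\<lambda>\<sigma>. g \<sigma> \<in> U)"
      using in_U by (auto simp: g_def)
    finally show "g -` U \<inter> space baire \<in> sets baire"
      by (simp add: pred_def vimage_def Int_def conj_commute)
  qed
  also have "measurable baire (sigma (topspace T) {U. openin T U}) = measurable baire X"
    by (rule measurable_cong_sets)
      (auto simp: T(4) intro!: sets_measure_of dest: openin_subset)
  finally have "g \<in> baire \<rightarrow>\<^sub>M X" .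
  moreover have "y \<in> range g" if "y \<in> S" for y
  proof -
    have "\<forall>n. \<exists>i. d (x i) y < (1/2) ^ (Suc n)" by (intro allI dense[OF that]) simp
    then obtain \<sigma> where \<sigma>: "\<And>n. d (x (\<sigma> n)) y < (1/2) ^ (Suc n)" by metis
    have "d (x (\<sigma> m)) (x (\<sigma> n)) \<le> (1/2) ^ m" if "m \<le> n" for m n
    proof -
      have "d (x (\<sigma> m)) (x (\<sigma> n)) \<le> d (x (\<sigma> m)) y + d (x (\<sigma> n)) y"
        using triangle[of "x (\<sigma> m)" y "x (\<sigma> n)"] commute[of y] x \<open>y \<in> S\<close> by simp
      also have "\<dots> \<le> (1/2) ^ Suc m + (1/2) ^ Suc n" using \<sigma>[of m] \<sigma>[of n] by simp
      also have "(1/2::real) ^ Suc n \<le> (1/2) ^ Suc m" by (rule power_decreasing) (use \<open>m \<le> n\<close> in auto)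
      finally show ?thesis by simp
    qed
    then have "\<sigma> \<in> G" by (auto simp: G_def)
    moreover have "limitin mtopology (\<lambda>n. x (\<sigma> n)) y sequentially"
    proof -
      have "(\<lambda>n. d (x (\<sigma> n)) y) \<longlonglongrightarrow> 0"
      proof (rule tendsto_sandwich[of "\<lambda>_. 0" _ _ "\<lambda>n. (1/2) ^ Suc n"])
        show "(\<lambda>n. (1/2::real) ^ Suc n) \<longlonglongrightarrow> 0" by (rule LIMSEQ_Suc) (rule LIMSEQ_power_zero, simp)
      qed (use less_imp_le[OF \<sigma>] in \<open>auto intro!: always_eventually simp del: power_Suc\<close>)
      then show ?thesis using x that by (simp add: limit_metric_sequentially LIMSEQ_def)
    qed
    ultimately have "g \<sigma> = y" using lim limitin_metric_unique[of "\<lambda>n. x (\<sigma> n)" "g \<sigma>" sequentially y] by auto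
    then show ?thesis by blast
  qed
  ultimately show ?thesis using gS S by (intro exI[of _ g]) auto
qed

theorem projection_univ_measurable:
  assumes Y: "standard_borel Y" and R: "R \<in> sets (M \<Otimes>\<^sub>M Y)"
  shows "{x \<in> space M. \<exists>y. (x, y) \<in> R} \<in> sets (univ_completion M)"
proof (cases "space Y = {}")
  case True
  then have "R = {}" using sets.sets_into_space[OF R] by (auto simp: space_pair_measure)
  then show ?thesis by simp
next
  case False
  then obtain g where g[measurable]: "g \<in> baire \<rightarrow>\<^sub>M Y" "range g = space Y"
    using baire_surjection[OF Y] by blast
  have "(\<lambda>(x, \<sigma>). (x, g \<sigma>)) \<in> M \<Otimes>\<^sub>M baire \<rightarrow>\<^sub>M M \<Otimes>\<^sub>M Y" by measurable
  from projection_baire_univ_measurable[OF measurable_sets[OF this R]]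
  have "{x \<in> space M. \<exists>\<sigma>. (x, g \<sigma>) \<in> R} \<in> sets (univ_completion M)"
    by (simp add: space_pair_measure space_PiM cong: conj_cong)
  moreover have "\<exists>\<sigma>. (x, g \<sigma>) \<in> R" if "(x, y) \<in> R" for x y
  proof -
    have "y \<in> range g" using sets.sets_into_space[OF R] g(2) that by (auto simp: space_pair_measure)
    with that show ?thesis by auto
  qed
  then have "(\<exists>y. (x, y) \<in> R) \<longleftrightarrow> (\<exists>\<sigma>. (x, g \<sigma>) \<in> R)" for x by blast
  ultimately show ?thesis by simp
qed

section \<open>The local lemma for partial assignments\<close>

text \<open>
  Avoiding the events one at a time: if each further event takes away at most the fraction \<open>x\<close> of
  what is left, then at least a fraction \<open>1 - x\<close> survives each step.
\<close>

lemma avoid_events_lower_bound: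
  fixes E :: "'i \<Rightarrow> 'w set" and x :: real
  assumes fin: "finite \<Omega>" "finite S" and x: "x < 1" and sub: "S2 \<subseteq> S" "T \<subseteq> S"
    and step: "\<And>j T'. \<lbrakk>j \<in> S; j \<notin> T'; T' \<subseteq> S\<rbrakk> \<Longrightarrow>
      card (E j \<inter> (\<Omega> - \<Union>(E ` T'))) \<le> x * card (\<Omega> - \<Union>(E ` T'))"
  shows "(1 - x) ^ card (T - S2) * card (\<Omega> - \<Union>(E ` S2)) \<le> card (\<Omega> - \<Union>(E ` (S2 \<union> T)))"
proof -
  define N where "N T = \<Omega> - \<Union>(E ` T)" for T
  have "finite T" using sub(2) fin(2) by (rule finite_subset)
  then show ?thesis using sub(2) unfolding N_def[symmetric]
  proof (induction T rule: finite_induct)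
    case (insert j T)
    show ?case
    proof (cases "j \<in> S2")
      case True
      then show ?thesis using insert by (simp add: insert_absorb)
    next
      case False
      let ?T = "S2 \<union> T"
      have "card (E j \<inter> N ?T) \<le> x * card (N ?T)"
        unfolding N_def using insert sub(1) False by (intro step) auto
      moreover have "card (N (insert j ?T)) = real (card (N ?T)) - card (E j \<inter> N ?T)"
      proof -
        have "N ?T = N (insert j ?T) \<union> (E j \<inter> N ?T)" "N (insert j ?T) \<inter> (E j \<inter> N ?T) = {}"
          by (auto simp: N_def)
        moreover have "finite (N (insert j ?T))" "finite (E j \<inter> N ?T)" using fin by (auto simp: N_def)
        ultimately show ?thesis using card_Un_disjoint[of "N (insert j ?T)" "E j \<inter> N ?T"] by simp
      qed
      ultimately have "(1 - x) * card (N ?T) \<le> card (N (insert j ?T))" by (simp add: algebra_simps)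
      moreover have "(1 - x) * ((1 - x) ^ card (T - S2) * card (N S2)) \<le> (1 - x) * card (N ?T)"
        using insert x by (intro mult_left_mono) auto
      moreover have "card (insert j T - S2) = Suc (card (T - S2))"
        using False insert by (simp add: insert_Diff_if)
      ultimately show ?thesis by (simp add: mult.assoc)
    qed
  qed simp
qed

text \<open>
  The usual induction: given that finitely many other events do not occur, the event \<open>E i\<close> has
  conditional probability at most \<open>x\<close>. The events outside \<open>\<Gamma> i\<close> are dropped by independence, and those
  in \<open>\<Gamma> i\<close> cost at most a factor \<open>1 - x\<close> each.
\<close>

lemma lovasz_local:
  fixes E :: "'i \<Rightarrow> 'w set" and x :: real
  assumes fin: "finite \<Omega>" "\<Omega> \<noteq> {}" "finite I" and x: "0 \<le> x" "x < 1"
    and \<Gamma>: "\<And>i. i \<in> I \<Longrightarrow> card (\<Gamma> i) \<le> d" "\<And>i. i \<in> I \<Longrightarrow> \<Gamma> i \<subseteq> I"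
    and indep: "\<And>i S. i \<in> I \<Longrightarrow> S \<subseteq> I - \<Gamma> i - {i} \<Longrightarrow>
      card (E i \<inter> (\<Omega> - \<Union>(E ` S))) * card \<Omega> = card (E i) * card (\<Omega> - \<Union>(E ` S))"
    and prob: "\<And>i. i \<in> I \<Longrightarrow> card (E i) \<le> x * (1 - x) ^ d * card \<Omega>"
  shows "\<Omega> - \<Union>(E ` I) \<noteq> {}"
proof -
  define N where "N T = \<Omega> - \<Union>(E ` T)" for T
  have finN: "finite (N T)" for T using fin by (auto simp: N_def)
  have card\<Omega>: "card \<Omega> > 0" using fin by (simp add: card_gt_0_iff)
  have main: "card (E i \<inter> N S) \<le> x * card (N S)" if "S \<subseteq> I" "i \<in> I" "i \<notin> S" for S i
    using that
  proof (induction "card S" arbitrary: S i rule: less_induct)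
    case less
    have finS: "finite S" using less.prems fin by (auto intro: finite_subset)
    define S2 where "S2 = S - \<Gamma> i"
    have "(1 - x) ^ card ((S \<inter> \<Gamma> i) - S2) * card (N S2) \<le> card (N (S2 \<union> (S \<inter> \<Gamma> i)))"
      unfolding N_def
    proof (rule avoid_events_lower_bound[where S=S])
      fix j T' assume j: "j \<in> S" "j \<notin> T'" "T' \<subseteq> S"
      then have "card T' < card S" using finS by (intro psubset_card_mono) auto
      then show "card (E j \<inter> (\<Omega> - \<Union>(E ` T'))) \<le> x * card (\<Omega> - \<Union>(E ` T'))"
        using less.hyps[of T' j] j less.prems unfolding N_def by auto
    qed (use fin finS x in \<open>auto simp: S2_def\<close>)
    moreover have "(S \<inter> \<Gamma> i) - S2 = S \<inter> \<Gamma> i" "S2 \<union> (S \<inter> \<Gamma> i) = S" by (auto simp: S2_def)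
    ultimately have low: "(1 - x) ^ card (S \<inter> \<Gamma> i) * card (N S2) \<le> card (N S)" by simp
    have "finite (\<Gamma> i)" using \<Gamma>(2)[OF less.prems(2)] fin(3) by (rule finite_subset)
    then have "card (S \<inter> \<Gamma> i) \<le> d"
      using card_mono[of "\<Gamma> i" "S \<inter> \<Gamma> i"] \<Gamma>(1)[OF less.prems(2)] by auto
    then have "(1 - x) ^ d \<le> (1 - x) ^ card (S \<inter> \<Gamma> i)" using x by (intro power_decreasing) auto
    then have "(1 - x) ^ d * card (N S2) \<le> card (N S)"
      using low by (meson mult_right_mono of_nat_0_le_iff order_trans)
    then have "x * ((1 - x) ^ d * card (N S2)) \<le> x * card (N S)" using x by (intro mult_left_mono) auto
    moreover have "real (card (E i \<inter> N S2)) \<le> x * (1 - x) ^ d * card (N S2)"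
    proof -
      have "card (E i \<inter> N S2) * card \<Omega> = card (E i) * card (N S2)"
        unfolding N_def using less.prems by (intro indep) (auto simp: S2_def)
      then have "real (card (E i \<inter> N S2)) * card \<Omega> = real (card (E i)) * card (N S2)"
        by (metis of_nat_mult)
      also have "\<dots> \<le> (x * (1 - x) ^ d * card \<Omega>) * card (N S2)"
        by (intro mult_right_mono prob less.prems) auto
      finally have "real (card (E i \<inter> N S2)) * card \<Omega> \<le> (x * (1 - x) ^ d * card (N S2)) * card \<Omega>"
        by (simp add: mult_ac)
      then show ?thesis using card\<Omega> by simp
    qed
    moreover have "card (E i \<inter> N S) \<le> card (E i \<inter> N S2)"
      using finN by (intro card_mono) (auto simp: N_def S2_def)
    ultimately show ?case by simp
  qed
  have "(1 - x) ^ card (I - {}) * card (\<Omega> - \<Union>(E ` {})) \<le> card (\<Omega> - \<Union>(E ` ({} \<union> I)))"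
    by (rule avoid_events_lower_bound[where S=I]) (use fin x main in \<open>auto simp: N_def\<close>)
  moreover have "0 < (1 - x) ^ card I * card \<Omega>" using x card\<Omega> by simp
  ultimately have "card (\<Omega> - \<Union>(E ` I)) \<noteq> 0" by auto
  then show ?thesis by (metis card.empty)
qed

lemma local_lemma_weight: "\<exists>x::real. 0 \<le> x \<and> x < 1 \<and> 1 / (exp 1 * (real d + 1)) \<le> x * (1 - x) ^ d"
proof (cases "d = 0")
  case True
  (* the usual weight 1 / (d + 1) would be 1 here *)
  have "1 / exp 1 < (1::real)" by simp
  then show ?thesis using True by (intro exI[of _ "1 / exp 1"]) auto
next
  case False
  define x where "x = 1 / (real d + 1)"
  have "(1 + 1 / real d) ^ d \<le> exp (1 / real d) ^ d"
    by (intro power_mono exp_ge_add_one_self) auto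
  also have "\<dots> = exp 1" using False by (simp flip: exp_of_nat_mult)
  finally have "1 / exp 1 \<le> 1 / (1 + 1 / real d) ^ d"
    by (intro divide_left_mono) (auto intro!: mult_pos_pos add_pos_nonneg zero_less_power)
  also have "\<dots> = (1 - x) ^ d" using False by (simp add: x_def field_simps flip: power_one_over power_divide)
  finally have "x * (1 / exp 1) \<le> x * (1 - x) ^ d" by (intro mult_left_mono) (auto simp: x_def)
  moreover have "x * (1 / exp 1) = 1 / (exp 1 * (real d + 1))" by (simp add: x_def)
  ultimately show ?thesis using False by (intro exI[of _ x]) (auto simp: x_def mult.commute)
qed

text \<open>
  Exchanging the values on \<open>D\<close> between the two members of a pair is an involution of
  \<open>\<Omega> \<times> \<Omega>\<close> that maps \<open>(A \<inter> B) \<times> \<Omega>\<close> onto \<open>A \<times> B\<close>.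
\<close>

lemma card_PiE_independent:
  assumes \<Omega>: "\<Omega> = K \<rightarrow>\<^sub>E Q" and AB: "A \<subseteq> \<Omega>" "B \<subseteq> \<Omega>"
    and A: "\<And>f g. f \<in> A \<Longrightarrow> g \<in> \<Omega> \<Longrightarrow> (\<And>x. x \<in> D \<Longrightarrow> f x = g x) \<Longrightarrow> g \<in> A"
    and B: "\<And>f g. f \<in> B \<Longrightarrow> g \<in> \<Omega> \<Longrightarrow> (\<And>x. x \<in> K - D \<Longrightarrow> f x = g x) \<Longrightarrow> g \<in> B"
  shows "card (A \<inter> B) * card \<Omega> = card A * card B"
proof -
  define m where "m f g x = (if x \<in> D then f x else g x)" for f g :: "'a \<Rightarrow> 'b" and x
  define \<phi> where "\<phi> = (\<lambda>(f, g). (m f g, m g f))"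
  have m: "m f g \<in> \<Omega>" if "f \<in> \<Omega>" "g \<in> \<Omega>" for f g
    using that unfolding \<Omega> m_def by (auto simp: PiE_iff extensional_def)
  have "bij_betw \<phi> ((A \<inter> B) \<times> \<Omega>) (A \<times> B)"
  proof (rule bij_betw_byWitness[where f'=\<phi>])
    show "\<phi> ` ((A \<inter> B) \<times> \<Omega>) \<subseteq> A \<times> B"
    proof (rule image_subsetI, clarify)
      fix f g assume fg: "f \<in> A" "f \<in> B" "g \<in> \<Omega>"
      have "m f g \<in> A" by (rule A[OF fg(1)]) (use fg AB in \<open>auto intro!: m simp: m_def\<close>)
      moreover have "m g f \<in> B" by (rule B[OF fg(2)]) (use fg AB in \<open>auto intro!: m simp: m_def\<close>)
      ultimately show "\<phi> (f, g) \<in> A \<times> B" by (simp add: \<phi>_def)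
    qed
    show "\<phi> ` (A \<times> B) \<subseteq> (A \<inter> B) \<times> \<Omega>"
    proof (rule image_subsetI, clarify)
      fix f g assume fg: "f \<in> A" "g \<in> B"
      have "m f g \<in> A" by (rule A[OF fg(1)]) (use fg AB in \<open>auto intro!: m simp: m_def\<close>)
      moreover have "m f g \<in> B" by (rule B[OF fg(2)]) (use fg AB in \<open>auto intro!: m simp: m_def\<close>)
      moreover have "m g f \<in> \<Omega>" using fg AB by (auto intro!: m)
      ultimately show "\<phi> (f, g) \<in> (A \<inter> B) \<times> \<Omega>" by (simp add: \<phi>_def)
    qed
  qed (auto simp: \<phi>_def m_def fun_eq_iff)
  from bij_betw_same_card[OF this] show ?thesis by (simp add: card_cartesian_product)
qed

lemma constraintsD:
  assumes "B \<in> constraints X q"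
  shows "finite B" "finite (cdom B)" "cdom B \<subseteq> X" "p \<in> B \<Longrightarrow> dom p = cdom B" "p \<in> B \<Longrightarrow> ran p \<subseteq> {..<q}"
proof -
  obtain D where D: "finite D" "D \<subseteq> X" "B \<subseteq> {p. dom p = D \<and> ran p \<subseteq> {..<q}}"
    using assms by (auto simp: constraints_def)
  have "{p. dom p = D \<and> ran p \<subseteq> {..<q}} \<subseteq> (\<lambda>f x. if x \<in> D then Some (f x) else None) ` (D \<rightarrow>\<^sub>E {..<q})"
  proof
    fix p :: "'a \<rightharpoonup> nat" assume p: "p \<in> {p. dom p = D \<and> ran p \<subseteq> {..<q}}"
    show "p \<in> (\<lambda>f x. if x \<in> D then Some (f x) else None) ` (D \<rightarrow>\<^sub>E {..<q})"
    proof (rule image_eqI)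
      show "p = (\<lambda>x. if x \<in> D then Some (restrict (the \<circ> p) D x) else None)" 
      proof
        fix x show "p x = (if x \<in> D then Some (restrict (the \<circ> p) D x) else None)"
          using p by (cases "p x") (auto simp: dom_def)
      qed
      have "the (p x) < q" if "x \<in> D" for x
      proof -
        have "x \<in> dom p" "ran p \<subseteq> {..<q}" using p that by auto
        then show ?thesis by (auto dest: ranI)
      qed
      then show "restrict (the \<circ> p) D \<in> D \<rightarrow>\<^sub>E {..<q}" by auto
    qed
  qed
  then have "finite {p::'a \<rightharpoonup> nat. dom p = D \<and> ran p \<subseteq> {..<q}}"
    by (rule finite_subset) (use D in \<open>auto intro!: finite_PiE\<close>)
  then show "finite B" using D(3) by (rule rev_finite_subset)
  have "cdom B \<subseteq> D" using D(3) by (auto simp: cdom_def)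
  then show "finite (cdom B)" "cdom B \<subseteq> X" using D by (auto intro: finite_subset)
  have dm: "dom p = D" if "p \<in> B" for p using D(3) that by blast
  have "dom p = cdom B" if "p \<in> B"
  proof -
    have "cdom B = (\<Union>p\<in>B. D)" unfolding cdom_def using dm by (intro SUP_cong refl)
    then show ?thesis using that dm by auto
  qed
  then show "p \<in> B \<Longrightarrow> dom p = cdom B" .
  show "p \<in> B \<Longrightarrow> ran p \<subseteq> {..<q}" using D(3) by blast
qed

text \<open>
  The conditional probability that \<open>B\<close> is violated when the values that \<open>g\<close> does not prescribe
  are chosen uniformly at random.
\<close>

definition partial_prob :: "nat \<Rightarrow> 'a constraint \<Rightarrow> ('a \<rightharpoonup> nat) \<Rightarrow> real" where
  "partial_prob q B g =
     real (card {p \<in> B. \<forall>x\<in>dom g \<inter> cdom B. p x = g x}) / real q ^ card (cdom B - dom g)"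

definition extend :: "('a \<rightharpoonup> nat) \<Rightarrow> 'a set \<Rightarrow> ('a \<Rightarrow> nat) \<Rightarrow> 'a \<rightharpoonup> nat" where
  "extend g K h x = (if x \<in> K then Some (h x) else g x)"

lemma dom_extend [simp]: "dom (extend g K h) = dom g \<union> K"
  by (auto simp: extend_def dom_def)

lemma partial_prob_empty [simp]: "partial_prob q B Map.empty = constraint_prob q B"
  by (simp add: partial_prob_def constraint_prob_def)

lemma partial_prob_cong:
  assumes "\<And>x. x \<in> cdom B \<Longrightarrow> g x = g' x"
  shows "partial_prob q B g = partial_prob q B g'"
proof -
  have "dom g \<inter> cdom B = dom g' \<inter> cdom B" "cdom B - dom g = cdom B - dom g'"
    using assms by (auto simp: dom_def)
  then show ?thesis using assms by (auto simp: partial_prob_def intro!: arg_cong[where f=card])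
qed

lemma partial_prob_nonneg: "0 \<le> partial_prob q B g"
  by (simp add: partial_prob_def)

lemma not_violates_if_partial_prob_less_1:
  assumes B: "B \<in> constraints X q" and g: "\<And>x. x \<in> cdom B \<Longrightarrow> g x = Some (f x)" and less: "partial_prob q B g < 1"
  shows "\<not> violates f B"
proof
  assume "violates f B"
  then have "(\<lambda>x. Some (f x)) |` cdom B \<in> {p \<in> B. \<forall>x\<in>dom g \<inter> cdom B. p x = g x}"
    by (auto simp: violates_def g)
  then have "card {p \<in> B. \<forall>x\<in>dom g \<inter> cdom B. p x = g x} > 0"
    unfolding card_gt_0_iff using constraintsD(1)[OF B] by (intro conjI) (blast, simp)
  moreover have eq: "cdom B - dom g = {}" using g by auto
  ultimately show False using less unfolding partial_prob_def eq by simp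
qed

lemma sum_partial_prob_extend:
  assumes B: "B \<in> constraints X q" and K: "finite K" "K \<inter> dom g = {}" and q: "q > 0"
  shows "(\<Sum>h\<in>K \<rightarrow>\<^sub>E {..<q}. partial_prob q B (extend g K h)) = real q ^ card K * partial_prob q B g"
proof -
  note BD = constraintsD[OF B]
  let ?C = "cdom B" and ?\<Omega> = "K \<rightarrow>\<^sub>E {..<q}"
  define B' where "B' = {p \<in> B. \<forall>x\<in>dom g \<inter> ?C. p x = g x}"
  have fin: "finite B'" "finite ?\<Omega>" using BD(1) K by (auto simp: B'_def intro!: finite_PiE)
  have cnt: "card {p \<in> B. \<forall>x\<in>dom (extend g K h) \<inter> ?C. p x = extend g K h x} =
      (\<Sum>p\<in>B'. if \<forall>x\<in>?C \<inter> K. p x = Some (h x) then 1 else 0)" for h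
  proof -
    have "{p \<in> B. \<forall>x\<in>dom (extend g K h) \<inter> ?C. p x = extend g K h x} = {p \<in> B'. \<forall>x\<in>?C \<inter> K. p x = Some (h x)}"
      using K(2) by (auto simp: B'_def extend_def)
    then show ?thesis using fin by (simp add: sum.If_cases Int_def)
  qed
  have ext: "(\<Sum>h\<in>?\<Omega>. if \<forall>x\<in>?C \<inter> K. p x = Some (h x) then 1 else (0::nat)) = q ^ card (K - ?C)"
    if p: "p \<in> B'" for p
  proof -
    have pv: "\<exists>v<q. p x = Some v" if "x \<in> ?C" for x
    proof -
      have "x \<in> dom p" "ran p \<subseteq> {..<q}" using p that BD(4)[of p] BD(5)[of p] by (auto simp: B'_def)
      then show ?thesis by (auto dest: ranI)
    qed
    have "{h \<in> ?\<Omega>. \<forall>x\<in>?C \<inter> K. p x = Some (h x)} = PiE K (\<lambda>x. if x \<in> ?C then {the (p x)} else {..<q})"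
      (is "?L = ?R")
    proof (intro equalityI subsetI)
      fix h assume "h \<in> ?L"
      then have h: "h \<in> ?\<Omega>" "\<And>x. x \<in> ?C \<inter> K \<Longrightarrow> p x = Some (h x)" by auto
      have "h x \<in> (if x \<in> ?C then {the (p x)} else {..<q})" if "x \<in> K" for x
        using h(2)[of x] PiE_mem[OF h(1) that] that by auto
      moreover have "h \<in> extensional K" using h(1) by (auto simp: PiE_iff)
      ultimately show "h \<in> ?R" by (auto simp: PiE_iff)
    next
      fix h assume h: "h \<in> ?R"
      have "p x = Some (h x) \<and> h x < q" if "x \<in> ?C \<inter> K" for x
      proof -
        have "h x = the (p x)" using PiE_mem[OF h, of x] that by auto
        then show ?thesis using pv[of x] that by auto
      qed
      moreover have "h x < q" if "x \<in> K - ?C" for x using PiE_mem[OF h, of x] that by auto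
      moreover have "h \<in> extensional K" using h by (auto simp: PiE_iff)
      ultimately show "h \<in> ?L" by (auto simp: PiE_iff)
    qed
    moreover have "card ?R = q ^ card (K - ?C)"
    proof -
      have "card ?R = (\<Prod>x\<in>K. if x \<in> ?C then 1 else q)" using K by (simp add: card_PiE if_distrib cong: if_cong)
      also have "\<dots> = q ^ card (K - ?C)" using K by (simp add: prod.If_cases Diff_eq)
      finally show ?thesis .
    qed
    moreover have "(\<Sum>h\<in>?\<Omega>. if \<forall>x\<in>?C \<inter> K. p x = Some (h x) then 1 else (0::nat)) = card ?L"
      using fin(2) by (simp add: sum.If_cases Int_def)
    ultimately show ?thesis by simp
  qed
  have "(\<Sum>h\<in>?\<Omega>. card {p \<in> B. \<forall>x\<in>dom (extend g K h) \<inter> ?C. p x = extend g K h x}) =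
      (\<Sum>p\<in>B'. \<Sum>h\<in>?\<Omega>. if \<forall>x\<in>?C \<inter> K. p x = Some (h x) then 1 else 0)"
    unfolding cnt by (rule sum.swap)
  also have "\<dots> = card B' * q ^ card (K - ?C)" by (simp add: ext)
  finally have "real (\<Sum>h\<in>?\<Omega>. card {p \<in> B. \<forall>x\<in>dom (extend g K h) \<inter> ?C. p x = extend g K h x}) =
      real (card B' * q ^ card (K - ?C))" by (rule arg_cong)
  then have sum: "(\<Sum>h\<in>?\<Omega>. partial_prob q B (extend g K h)) =
      card B' * real q ^ card (K - ?C) / real q ^ card (?C - (dom g \<union> K))"
    by (simp only: partial_prob_def dom_extend flip: sum_divide_distrib of_nat_sum) simp
  have "card (?C - dom g) = card (?C - (dom g \<union> K)) + card (?C \<inter> K)"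
    using BD(2) K by (subst card_Un_disjoint[symmetric]) (auto intro!: arg_cong[where f=card])
  moreover have "card K = card (K - ?C) + card (?C \<inter> K)"
    using K by (subst card_Un_disjoint[symmetric]) (auto intro!: arg_cong[where f=card])
  ultimately show ?thesis
    unfolding sum using q by (simp add: partial_prob_def power_add field_simps flip: B'_def)
qed

text \<open>
  By Markov's inequality a random assignment on \<open>K\<close> pushes the conditional probability of a given
  constraint from \<open>s\<close> to \<open>e (d + 1) s\<close> with probability at most \<open>1 / (e (d + 1))\<close>, and that is the bound
  that the local lemma needs in order to avoid this for all constraints at once.
\<close>

lemma extend_partial_assignment:
  assumes q: "q > 0" and \<B>: "\<B> \<subseteq> constraints X q"
    and d: "\<And>B. B \<in> \<B> \<Longrightarrow> finite (constraint_nbrs \<B> B) \<and> card (constraint_nbrs \<B> B) \<le> d"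
    and fin: "finite \<A>" "\<A> \<subseteq> \<B>" and K: "finite K" "K \<inter> dom g = {}"
    and s: "s > 0" "\<And>B. B \<in> \<A> \<Longrightarrow> partial_prob q B g \<le> s"
  shows "\<exists>h\<in>K \<rightarrow>\<^sub>E {..<q}. \<forall>B\<in>\<A>. partial_prob q B (extend g K h) < s * (exp 1 * (real d + 1))"
proof -
  let ?\<Omega> = "K \<rightarrow>\<^sub>E {..<q}"
  define t where "t = s * (exp 1 * (real d + 1))"
  have t: "t > 0" using s(1) by (simp add: t_def add_nonneg_pos)
  have fin\<Omega>: "finite ?\<Omega>" using K by (auto intro!: finite_PiE)
  have card\<Omega>: "card ?\<Omega> = q ^ card K" using K by (simp add: card_PiE)
  define E where "E B = {h \<in> ?\<Omega>. t \<le> partial_prob q B (extend g K h)}" for B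
  define \<Gamma> where "\<Gamma> B = {B' \<in> \<A>. B' \<noteq> B \<and> cdom B' \<inter> cdom B \<noteq> {}}" for B
  obtain x :: real where x: "0 \<le> x" "x < 1" "1 / (exp 1 * (real d + 1)) \<le> x * (1 - x) ^ d"
    using local_lemma_weight by blast
  have E_dep: "h' \<in> E B" if "h \<in> E B" "h' \<in> ?\<Omega>" "\<And>y. y \<in> K \<inter> cdom B \<Longrightarrow> h y = h' y" for B h h'
  proof -
    have "partial_prob q B (extend g K h) = partial_prob q B (extend g K h')"
      by (rule partial_prob_cong) (use that in \<open>auto simp: extend_def\<close>)
    then show ?thesis using that by (simp add: E_def)
  qed
  have "?\<Omega> - \<Union>(E ` \<A>) \<noteq> {}"
  proof (rule lovasz_local[OF fin\<Omega> _ fin(1) x(1,2), of \<Gamma> d])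
    show "?\<Omega> \<noteq> {}" using q by (auto simp: PiE_eq_empty_iff)
    fix B assume B: "B \<in> \<A>"
    have "\<Gamma> B \<subseteq> constraint_nbrs \<B> B" using fin(2) by (auto simp: \<Gamma>_def constraint_nbrs_def)
    then show "card (\<Gamma> B) \<le> d" using d[of B] B fin(2) by (meson card_mono order_trans subsetD)
    show "\<Gamma> B \<subseteq> \<A>" by (auto simp: \<Gamma>_def)
    show "card (E B \<inter> (?\<Omega> - \<Union>(E ` S))) * card ?\<Omega> = card (E B) * card (?\<Omega> - \<Union>(E ` S))"
      if S: "S \<subseteq> \<A> - \<Gamma> B - {B}" for S
    proof (rule card_PiE_independent[OF refl, where D="K \<inter> cdom B"])
      show "f' \<in> E B" if "f \<in> E B" "f' \<in> ?\<Omega>" "\<And>y. y \<in> K \<inter> cdom B \<Longrightarrow> f y = f' y" for f f'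
        using E_dep[OF that] .
      fix f f' assume f: "f \<in> ?\<Omega> - \<Union>(E ` S)" "f' \<in> ?\<Omega>" "\<And>y. y \<in> K - (K \<inter> cdom B) \<Longrightarrow> f y = f' y"
      have "f' \<notin> E B'" if "B' \<in> S" for B'
      proof
        assume "f' \<in> E B'"
        moreover have "cdom B' \<inter> cdom B = {}" using S that by (auto simp: \<Gamma>_def)
        then have "f' y = f y" if "y \<in> K \<inter> cdom B'" for y using f(3)[of y, symmetric] that by auto
        ultimately have "f \<in> E B'" using E_dep[of f' B' f] f(1) by blast
        then show False using f(1) that by auto
      qed
      then show "f' \<in> ?\<Omega> - \<Union>(E ` S)" using f(2) by auto
    qed (auto simp: E_def)
    have "B \<in> constraints X q" using B fin(2) \<B> by auto
    have "t * card (E B) = (\<Sum>h\<in>E B. t)" by simp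
    also have "\<dots> \<le> (\<Sum>h\<in>E B. partial_prob q B (extend g K h))" by (rule sum_mono) (auto simp: E_def)
    also have "\<dots> \<le> (\<Sum>h\<in>?\<Omega>. partial_prob q B (extend g K h))"
      using fin\<Omega> by (intro sum_mono2) (auto simp: E_def partial_prob_nonneg)
    also have "\<dots> = card ?\<Omega> * partial_prob q B g"
      using sum_partial_prob_extend[OF \<open>B \<in> constraints X q\<close> K q] by (simp add: card\<Omega>)
    also have "\<dots> \<le> card ?\<Omega> * s" using s(2)[OF B] by (intro mult_left_mono) auto
    finally have "s * ((exp 1 * (real d + 1)) * card (E B)) \<le> s * card ?\<Omega>" by (simp add: t_def mult_ac)
    then have "(exp 1 * (real d + 1)) * card (E B) \<le> card ?\<Omega>" using s(1) by simp
    then have "card (E B) \<le> 1 / (exp 1 * (real d + 1)) * card ?\<Omega>"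
      by (simp add: field_simps add_pos_nonneg)
    also have "\<dots> \<le> x * (1 - x) ^ d * card ?\<Omega>" by (intro mult_right_mono x(3)) auto
    finally show "card (E B) \<le> x * (1 - x) ^ d * card ?\<Omega>" .
  qed
  then obtain h where h: "h \<in> ?\<Omega>" "\<And>B. B \<in> \<A> \<Longrightarrow> h \<notin> E B" by blast
  have "partial_prob q B (extend g K h) < t" if "B \<in> \<A>" for B
    using h that by (auto simp: E_def not_le)
  then show ?thesis using h(1) unfolding t_def by blast
qed

lemma violates_iff:
  assumes "B \<in> constraints X q"
  shows "violates f B \<longleftrightarrow> (\<exists>p\<in>B. \<forall>x\<in>cdom B. p x = Some (f x))"
proof
  assume "violates f B"
  then show "\<exists>p\<in>B. \<forall>x\<in>cdom B. p x = Some (f x)" unfolding violates_def by (rule bexI[rotated]) simp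
next
  assume "\<exists>p\<in>B. \<forall>x\<in>cdom B. p x = Some (f x)"
  then obtain p where p: "p \<in> B" "\<And>x. x \<in> cdom B \<Longrightarrow> p x = Some (f x)" by blast
  have "p x = ((\<lambda>x. Some (f x)) |` cdom B) x" for x
    using p(2)[of x] constraintsD(4)[OF assms p(1)] by (cases "x \<in> cdom B") (auto simp: restrict_map_def dom_def)
  then have "(\<lambda>x. Some (f x)) |` cdom B = p" by auto
  then show "violates f B" using p(1) by (simp add: violates_def)
qed

section \<open>Solutions without measurability\<close>

locale sparse_csp =
  fixes X :: "'a set" and q d :: nat and \<B> :: "'a constraint set"
  assumes q_pos: "q > 0"
    and constraints: "\<B> \<subseteq> constraints X q"
    and nbrs: "\<And>B. B \<in> \<B> \<Longrightarrow> finite (constraint_nbrs \<B> B) \<and> card (constraint_nbrs \<B> B) \<le> d"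
begin

lemma finite_constraints_at: "finite {B \<in> \<B>. x \<in> cdom B}"
proof (cases "\<exists>B\<in>\<B>. x \<in> cdom B")
  case True
  then obtain B where B: "B \<in> \<B>" "x \<in> cdom B" by blast
  have "{B \<in> \<B>. x \<in> cdom B} \<subseteq> insert B (constraint_nbrs \<B> B)"
    using B by (auto simp: constraint_nbrs_def)
  then show ?thesis using nbrs[OF B(1)] by (auto intro: finite_subset)
next
  case False
  then have "{B \<in> \<B>. x \<in> cdom B} = {}" by blast
  then show ?thesis by (simp only: finite.emptyI)
qed

text \<open>
  Finitely many constraints have a common solution by the local lemma, and the space of all functions
  to a finite set is compact. Compactness says nothing about measurability, but on a null set this
  solution is good enough.
\<close>

lemma solution_exists:
  assumes s: "s > 0" "s * (exp 1 * (real d + 1)) \<le> 1" "\<And>B. B \<in> \<B> \<Longrightarrow> constraint_prob q B \<le> s"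
  shows "\<exists>f. csp_solution X q \<B> f"
proof -
  define T where "T = product_topology (\<lambda>_. discrete_topology {..<q}) X"
  have topT: "topspace T = X \<rightarrow>\<^sub>E {..<q}" by (simp add: T_def)
  have compact: "compact_space T" by (simp add: T_def compact_space_product_topology compact_space_discrete_topology)
  define C where "C B = {f \<in> X \<rightarrow>\<^sub>E {..<q}. \<not> violates f B}" for B
  have closed: "closedin T (C B)" if "B \<in> \<B>" for B
  proof -
    have B: "B \<in> constraints X q" using that constraints by auto
    have op: "openin T {f \<in> topspace T. f x \<in> S}" if "x \<in> X" "S \<subseteq> {..<q}" for x S
      using openin_continuous_map_preimage[OF continuous_map_product_projection[OF that(1)], of "\<lambda>_. discrete_topology {..<q}" S] that
      by (simp add: T_def)
    have "openin T (topspace T \<inter> (\<Union>p\<in>B. topspace T \<inter> (\<Inter>x\<in>cdom B. {f \<in> topspace T. f x \<in> {v. v < q \<and> p x = Some v}})))"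
    proof (intro openin_Int openin_topspace openin_Union ballI)
      fix S assume "S \<in> (\<lambda>p. topspace T \<inter> (\<Inter>x\<in>cdom B. {f \<in> topspace T. f x \<in> {v. v < q \<and> p x = Some v}})) ` B"
      then obtain p where S: "S = topspace T \<inter> (\<Inter>x\<in>cdom B. {f \<in> topspace T. f x \<in> {v. v < q \<and> p x = Some v}})" by auto
      show "openin T S"
      proof (cases "cdom B = {}")
        case False
        then show ?thesis unfolding S using constraintsD(2,3)[OF B]
          by (intro openin_Int openin_topspace openin_INT2 op) auto
      qed (simp add: S)
    qed
    also have "topspace T \<inter> (\<Union>p\<in>B. topspace T \<inter> (\<Inter>x\<in>cdom B. {f \<in> topspace T. f x \<in> {v. v < q \<and> p x = Some v}})) =
        topspace T - C B"
    proof -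
      have "f x < q" if "f \<in> topspace T" "x \<in> cdom B" for f x
        using that constraintsD(3)[OF B] by (auto simp: topT PiE_iff)
      then show ?thesis unfolding C_def violates_iff[OF B] topT[symmetric] by (auto; blast)
    qed
    finally have "openin T (topspace T - C B)" .
    moreover have "C B \<subseteq> topspace T" by (auto simp: C_def topT)
    ultimately show ?thesis by (simp add: closedin_def)
  qed
  have "\<Inter>(insert (topspace T) (C ` \<B>)) \<noteq> {}"
  proof (rule compact[unfolded compact_space_fip, rule_format], intro conjI ballI allI impI)
    show "closedin T S" if "S \<in> insert (topspace T) (C ` \<B>)" for S using that closed by auto
    fix \<F> assume \<F>: "finite \<F> \<and> \<F> \<subseteq> insert (topspace T) (C ` \<B>)"
    then have "finite (\<F> - {topspace T})" "\<F> - {topspace T} \<subseteq> C ` \<B>" by auto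
    then obtain \<A> where \<A>: "\<A> \<subseteq> \<B>" "finite \<A>" "\<F> - {topspace T} = C ` \<A>"
      using finite_subset_image by metis
    define K where "K = (\<Union>B\<in>\<A>. cdom B)"
    have K: "finite K" "K \<subseteq> X" using \<A> constraints constraintsD(2,3) by (fastforce simp: K_def)+
    obtain h where h: "h \<in> K \<rightarrow>\<^sub>E {..<q}"
      "\<And>B. B \<in> \<A> \<Longrightarrow> partial_prob q B (extend Map.empty K h) < s * (exp 1 * (real d + 1))"
    proof -
      have "\<exists>h\<in>K \<rightarrow>\<^sub>E {..<q}. \<forall>B\<in>\<A>. partial_prob q B (extend Map.empty K h) < s * (exp 1 * (real d + 1))"
        using s \<A>(1) by (intro extend_partial_assignment[OF q_pos constraints nbrs \<A>(2,1) K(1)]) auto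
      then show ?thesis using that by blast
    qed
    define f where "f = restrict (\<lambda>x. if x \<in> K then h x else 0) X"
    have f: "f \<in> topspace T" using h(1) q_pos by (auto simp: f_def topT)
    moreover have "f \<in> C B" if "B \<in> \<A>" for B
    proof -
      have B: "B \<in> constraints X q" using that \<A> constraints by auto
      have "\<not> violates f B"
      proof (rule not_violates_if_partial_prob_less_1[OF B])
        show "extend Map.empty K h x = Some (f x)" if "x \<in> cdom B" for x
          using that \<open>B \<in> \<A>\<close> K by (auto simp: extend_def f_def K_def)
        show "partial_prob q B (extend Map.empty K h) < 1" using h(2)[OF that] s(2) by simp
      qed
      then show ?thesis using f by (simp add: C_def topT)
    qed
    ultimately have "f \<in> \<Inter>\<F>" using \<A>(3) by blast
    then show "\<Inter>\<F> \<noteq> {}" by blast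
  qed
  then obtain f where "f \<in> topspace T" "\<And>B. B \<in> \<B> \<Longrightarrow> f \<in> C B" by blast
  then show ?thesis unfolding csp_solution_def by (intro exI[of _ f]) (auto simp: topT C_def)
qed

end

section \<open>Measurable enumeration of finite sections\<close>

lemma countable_isolating_family:
  assumes "standard_borel X"
  shows "\<exists>V::nat \<Rightarrow> 'a set. (\<forall>n. V n \<in> sets X) \<and>
    (\<forall>F y. finite F \<longrightarrow> F \<subseteq> space X \<longrightarrow> y \<in> F \<longrightarrow> (\<exists>n. V n \<inter> F = {y}))"
proof -
  obtain T where T: "completely_metrizable_space T" "second_countable T" "topspace T = space X"
      "sets X = sigma_sets (topspace T) {U. openin T U}"
    using assms by (auto simp: standard_borel_def)
  obtain \<V> where \<V>0: "countable \<V> \<and> (\<forall>V\<in>\<V>. openin T V) \<and>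
      (\<forall>U x. openin T U \<and> x \<in> U \<longrightarrow> (\<exists>V\<in>\<V>. x \<in> V \<and> V \<subseteq> U))"
    using T(2) unfolding second_countable_def by (rule exE)
  then have \<V>: "countable \<V>" "\<And>V. V \<in> \<V> \<Longrightarrow> openin T V"
      "\<And>U x. openin T U \<Longrightarrow> x \<in> U \<Longrightarrow> \<exists>V\<in>\<V>. x \<in> V \<and> V \<subseteq> U"
    by simp_all
  define V where "V = from_nat_into (insert {} \<V>)"
  have V_range: "range V = insert {} \<V>"
    unfolding V_def using \<V>(1) by (intro range_from_nat_into) auto
  have V_open: "openin T (V n)" for n using V_range \<V>(2) by (metis insertE openin_empty rangeI)
  have "\<exists>n. V n \<inter> F = {y}" if F: "finite F" "F \<subseteq> space X" "y \<in> F" for F y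
  proof -
    have "t1_space T"
      using T(1) by (intro Hausdorff_imp_t1_space metrizable_imp_Hausdorff_space
          completely_metrizable_imp_metrizable_space)
    then have "closedin T (F - {y})"
      using F T(3) unfolding t1_space_closedin_finite by auto
    then have "openin T (topspace T - (F - {y}))" by (rule openin_diff[OF openin_topspace])
    then obtain W where "W \<in> \<V>" "y \<in> W" "W \<subseteq> topspace T - (F - {y})"
      using \<V>(3)[of _ y] F T(3) by blast
    moreover from this(1) obtain n where "V n = W" using V_range by (metis imageE insertCI)
    ultimately show ?thesis using F(3) by (intro exI[of _ n]) auto
  qed
  moreover have "V n \<in> sets X" for n using V_open[of n] by (auto simp: T(4) intro: sigma_sets.Basic)
  ultimately show ?thesis by blast
qed

text \<open>
  A Luzin-Novikov type theorem for finite sections, with universally measurable instead of Borel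
  functions: the \<open>i\<close>-th function picks the element of the section that lies in the \<open>i\<close>-th set of an
  isolating family if it is the only one there, and the point \<open>x\<close> itself otherwise.
\<close>

theorem measurable_enumeration_of_sections:
  assumes X: "standard_borel X" and E: "E \<in> sets (X \<Otimes>\<^sub>M X)"
    and fin: "\<And>x. x \<in> space X \<Longrightarrow> finite {y. (x, y) \<in> E}" and refl: "\<And>x. x \<in> space X \<Longrightarrow> (x, x) \<in> E"
  shows "\<exists>f::nat \<Rightarrow> 'a \<Rightarrow> 'a. (\<forall>i. f i \<in> univ_completion X \<rightarrow>\<^sub>M univ_completion X) \<and>
    (\<forall>x\<in>space X. range (\<lambda>i. f i x) = {y. (x, y) \<in> E})"
proof -
  obtain V :: "nat \<Rightarrow> 'a set" where V: "\<And>n. V n \<in> sets X"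
    "\<And>F y. finite F \<Longrightarrow> F \<subseteq> space X \<Longrightarrow> y \<in> F \<Longrightarrow> \<exists>n. V n \<inter> F = {y}"
    using countable_isolating_family[OF X] by blast
  have E_sub: "E \<subseteq> space X \<times> space X" using sets.sets_into_space[OF E] by (simp add: space_pair_measure)
  define P where "P W = {x \<in> space X. \<exists>y. (x, y) \<in> E \<and> y \<in> W}" for W
  have P: "P W \<in> sets (univ_completion X)" if "W \<in> sets X" for W
  proof -
    have "E \<inter> (space X \<times> W) \<in> sets (X \<Otimes>\<^sub>M X)" using E that by auto
    from projection_univ_measurable[OF X this] show ?thesis
      by (rule back_subst[where P="\<lambda>A. A \<in> _"]) (auto simp: P_def)
  qed
  (* two elements of a section in V i are separated by some V n; so Q i has the points with exactly one *)
  define Q where "Q i = P (V i) - (\<Union>n. P (V i \<inter> V n) \<inter> P (V i - V n))" for i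
  have Q: "Q i \<in> sets (univ_completion X)" for i
    unfolding Q_def using V(1) by (intro sets.Diff sets.countable_UN sets.Int P image_subsetI) auto
  have Q_iff: "x \<in> Q i \<longleftrightarrow> (\<exists>!y. (x, y) \<in> E \<and> y \<in> V i)" if x: "x \<in> space X" for x i
  proof
    assume x': "x \<in> Q i"
    show "\<exists>!y. (x, y) \<in> E \<and> y \<in> V i"
    proof (rule ex_ex1I)
      show "\<exists>y. (x, y) \<in> E \<and> y \<in> V i" using x' by (auto simp: Q_def P_def)
      fix y z assume yz: "(x, y) \<in> E \<and> y \<in> V i" "(x, z) \<in> E \<and> z \<in> V i"
      show "y = z"
      proof (rule ccontr)
        assume "y \<noteq> z"
        obtain n where "V n \<inter> {y, z} = {y}" using V(2)[of "{y, z}" y] yz E_sub by auto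
        then have "y \<in> V n" "z \<notin> V n" using \<open>y \<noteq> z\<close> by auto
        then have "x \<in> P (V i \<inter> V n) \<inter> P (V i - V n)" using yz x by (auto simp: P_def)
        then show False using x' by (auto simp: Q_def)
      qed
    qed
  next
    assume "\<exists>!y. (x, y) \<in> E \<and> y \<in> V i"
    then show "x \<in> Q i" using x by (auto simp: Q_def P_def)
  qed
  define f where "f i x = (if x \<in> Q i then THE y. (x, y) \<in> E \<and> y \<in> V i else x)" for i x
  have f_Q: "f i x = y" if "x \<in> Q i" "(x, y) \<in> E" "y \<in> V i" for i x y
  proof -
    have "x \<in> space X" using that E_sub by auto
    then show ?thesis using that Q_iff[of x i] by (auto simp: f_def intro!: the1_equality)
  qed
  have f_E: "(x, f i x) \<in> E" if "x \<in> space X" for x i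
  proof (cases "x \<in> Q i")
    case True
    then have "\<exists>y. (x, y) \<in> E \<and> y \<in> V i" using Q_iff[OF that, of i] by blast
    then obtain y where "(x, y) \<in> E" "y \<in> V i" by blast
    then show ?thesis using f_Q[OF True] by auto
  qed (use refl[OF that] in \<open>simp add: f_def\<close>)
  have "f i \<in> univ_completion X \<rightarrow>\<^sub>M X" for i
  proof (rule measurableI)
    show "f i x \<in> space X" if "x \<in> space (univ_completion X)" for x using f_E[of x i] that E_sub by auto
    fix A assume A: "A \<in> sets X"
    have inQ: "f i x \<in> A \<longleftrightarrow> x \<in> P (V i \<inter> A)" if xQ: "x \<in> Q i" "x \<in> space X" for x
    proof -
      have "\<exists>y. (x, y) \<in> E \<and> y \<in> V i" using Q_iff[OF xQ(2), of i] xQ(1) by blast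
      then obtain y where y: "(x, y) \<in> E" "y \<in> V i" by blast
      have "f i x = z" if "(x, z) \<in> E" "z \<in> V i" for z using f_Q[OF xQ(1) that] .
      then show ?thesis using y xQ(2) by (auto simp: P_def)
    qed
    have notQ: "f i x = x" if "x \<notin> Q i" for x using that by (simp add: f_def)
    have "f i -` A \<inter> space (univ_completion X) = (Q i \<inter> P (V i \<inter> A)) \<union> (A - Q i)"
    proof (rule set_eqI)
      fix x
      show "x \<in> f i -` A \<inter> space (univ_completion X) \<longleftrightarrow> x \<in> (Q i \<inter> P (V i \<inter> A)) \<union> (A - Q i)"
        using inQ[of x] notQ[of x] sets.sets_into_space[OF A] sets.sets_into_space[OF Q[of i]]
        by (cases "x \<in> Q i") auto
    qed
    also have "\<dots> \<in> sets (univ_completion X)"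
      using Q P V(1) A sets_subset_sets_univ_completion[of X] by (intro sets.Un sets.Int sets.Diff) auto
    finally show "f i -` A \<inter> space (univ_completion X) \<in> sets (univ_completion X)" .
  qed
  then have "f i \<in> univ_completion X \<rightarrow>\<^sub>M univ_completion X" for i by (rule measurable_univ_completion)
  moreover have "range (\<lambda>i. f i x) = {y. (x, y) \<in> E}" if x: "x \<in> space X" for x
  proof (intro equalityI subsetI)
    fix y assume "y \<in> {y. (x, y) \<in> E}"
    then have y: "(x, y) \<in> E" by simp
    have "{y. (x, y) \<in> E} \<subseteq> space X" using E_sub by auto
    then obtain i where i: "V i \<inter> {y. (x, y) \<in> E} = {y}" using V(2)[OF fin[OF x]] y by blast
    then have yV: "y \<in> V i" and un: "\<And>z. (x, z) \<in> E \<Longrightarrow> z \<in> V i \<Longrightarrow> z = y" by auto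
    then have "\<exists>!y. (x, y) \<in> E \<and> y \<in> V i" using y un by blast
    then have "x \<in> Q i" using Q_iff[OF x] by simp
    then have "f i x = y" using y yV by (rule f_Q)
    then show "y \<in> range (\<lambda>i. f i x)" by auto
  qed (use f_E[OF x] in auto)
  ultimately show ?thesis by blast
qed

section \<open>Coding the constraints at a point\<close>

text \<open>
  A finite set is measurable as a function of a parameter as soon as it is listed without repetition by
  measurable functions: this is what the quotient structure from the tuples of distinct points provides.
\<close>

lemma image_measurable_finite_subsets:
  fixes k :: nat
  assumes g: "\<And>j. j < k \<Longrightarrow> g j \<in> N \<rightarrow>\<^sub>M M" and inj: "\<And>t. t \<in> space N \<Longrightarrow> inj_on (\<lambda>j. g j t) {..<k}"
  shows "(\<lambda>t. (\<lambda>j. g j t) ` {..<k}) \<in> N \<rightarrow>\<^sub>M finite_subsets M"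
proof -
  have "(\<lambda>x. x ` {..<k}) \<in> distinct_tuples M k \<rightarrow>\<^sub>M finite_subsets M"
  proof (rule measurableI)
    show "x ` {..<k} \<in> space (finite_subsets M)" if "x \<in> space (distinct_tuples M k)" for x
      using that by (auto simp: space_finite_subsets distinct_tuples_def space_restrict_space space_PiM)
    fix A assume "A \<in> sets (finite_subsets M)"
    then have "{x \<in> space (distinct_tuples M k). x ` {..<k} \<in> A} \<in> sets (distinct_tuples M k)"
      by (simp add: sets_finite_subsets)
    also have "{x \<in> space (distinct_tuples M k). x ` {..<k} \<in> A} =
        (\<lambda>x. x ` {..<k}) -` A \<inter> space (distinct_tuples M k)" by auto
    finally show "(\<lambda>x. x ` {..<k}) -` A \<inter> space (distinct_tuples M k) \<in> sets (distinct_tuples M k)" .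
  qed
  moreover have "(\<lambda>t. \<lambda>j\<in>{..<k}. g j t) \<in> N \<rightarrow>\<^sub>M distinct_tuples M k"
    unfolding distinct_tuples_def
  proof (rule measurable_restrict_space2)
    show "(\<lambda>t. \<lambda>j\<in>{..<k}. g j t) \<in> space N \<rightarrow> {x. inj_on x {..<k}}"
      using inj by (auto simp: inj_on_def)
    show "(\<lambda>t. \<lambda>j\<in>{..<k}. g j t) \<in> N \<rightarrow>\<^sub>M (\<Pi>\<^sub>M i\<in>{..<k}. M)"
      using g by (intro measurable_restrict) auto
  qed
  ultimately have "(\<lambda>t. (\<lambda>j\<in>{..<k}. g j t) ` {..<k}) \<in> N \<rightarrow>\<^sub>M finite_subsets M"
    by (rule measurable_compose[rotated])
  moreover have "(\<lambda>j\<in>{..<k}. g j t) ` {..<k} = (\<lambda>j. g j t) ` {..<k}" for t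
    by (rule image_cong) auto
  ultimately show ?thesis by (simp only:)
qed

text \<open>
  A constraint is split into the points of its domain and a combinatorial part that does not mention
  points: the list of the words that its violating assignments spell along \<open>xs\<close>. There are only
  countably many possibilities for the second part.
\<close>

definition decode :: "'a list \<Rightarrow> nat list list \<Rightarrow> 'a constraint" where
  "decode xs Ws = (\<lambda>w. map_of (zip xs w)) ` set Ws"

definition valid_words :: "nat \<Rightarrow> nat \<Rightarrow> nat list list \<Rightarrow> bool" where
  "valid_words q k Ws \<longleftrightarrow> distinct Ws \<and> (\<forall>w\<in>set Ws. length w = k \<and> set w \<subseteq> {..<q})"

lemma map_of_zip_inj:
  assumes "distinct xs" "length v = length xs" "length w = length xs" "map_of (zip xs v) = map_of (zip xs w)"
  shows "v = w"
proof (rule nth_equalityI)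
  fix i assume "i < length v"
  then show "v ! i = w ! i"
    using assms map_of_zip_nth[of xs v i] map_of_zip_nth[of xs w i] by simp
qed (use assms in simp)

lemma dom_decode:
  assumes "p \<in> decode xs Ws" "valid_words q (length xs) Ws"
  shows "dom p = set xs"
proof -
  obtain w where "w \<in> set Ws" "p = map_of (zip xs w)" using assms(1) by (auto simp: decode_def)
  then show ?thesis using assms(2) dom_map_of_zip[of xs w] by (simp add: valid_words_def)
qed

lemma cdom_decode:
  assumes "valid_words q (length xs) Ws" "Ws \<noteq> []"
  shows "cdom (decode xs Ws) = set xs"
proof -
  have "cdom (decode xs Ws) = (\<Union>p\<in>decode xs Ws. set xs)"
    unfolding cdom_def using dom_decode[OF _ assms(1)] by (intro SUP_cong) auto
  moreover have "decode xs Ws \<noteq> {}" using assms(2) by (simp add: decode_def)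
  ultimately show ?thesis by auto
qed

lemma decode_measurable:
  fixes X :: "'a measure"
  assumes g: "\<And>i. i \<in> set is \<Longrightarrow> g i \<in> N \<rightarrow>\<^sub>M X" and dist: "\<And>t. t \<in> space N \<Longrightarrow> distinct (map (\<lambda>i. g i t) is)"
    and Ws: "valid_words q (length is) Ws"
  shows "(\<lambda>t. decode (map (\<lambda>i. g i t) is) Ws) \<in> N \<rightarrow>\<^sub>M constraint_space X q"
proof -
  define k where "k = length is"
  let ?p = "\<lambda>w t. map_of (zip (map (\<lambda>i. g i t) is) w)"
  have g': "g (is ! j) \<in> N \<rightarrow>\<^sub>M X" if "j < k" for j using g that by (simp add: k_def)
  have sp: "g i t \<in> space X" if "i \<in> set is" "t \<in> space N" for i t using measurable_space[OF g] that by auto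
  have inj: "inj_on (\<lambda>j. g (is ! j) t) {..<k}" if "t \<in> space N" for t
    using dist[OF that] by (auto simp: inj_on_def distinct_conv_nth k_def)
  have p: "?p w \<in> N \<rightarrow>\<^sub>M pfun_space X q" if w: "w \<in> set Ws" for w
    unfolding pfun_space_def
  proof (rule measurable_vimage_algebra2)
    have lw: "length w = k" "set w \<subseteq> {..<q}" using Ws w by (auto simp: valid_words_def k_def)
    have ran: "ran (map_of xs) \<subseteq> snd ` set xs" for xs :: "('a \<times> nat) list"
      by (force simp: ran_def dest!: map_of_SomeD)
    have rw: "ran (map_of (zip ys w)) \<subseteq> {..<q}" for ys :: "'a list"
    proof
      fix v assume "v \<in> ran (map_of (zip ys w))"
      then have "v \<in> snd ` set (zip ys w)" using ran by blast
      then show "v \<in> {..<q}" using lw(2) by (auto dest: set_zip_rightD)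
    qed
    have dw: "dom (?p w t) = set (map (\<lambda>i. g i t) is)" for t
      using lw by (intro dom_map_of_zip) (simp add: k_def)
    show "?p w \<in> space N \<rightarrow> {p. finite (dom p) \<and> dom p \<subseteq> space X \<and> ran p \<subseteq> {..<q}}"
    proof (intro Pi_I CollectI conjI)
      fix t assume "t \<in> space N"
      then show "dom (?p w t) \<subseteq> space X" unfolding dw using sp by auto
      show "finite (dom (?p w t))" unfolding dw by simp
      show "ran (?p w t) \<subseteq> {..<q}" by (rule rw)
    qed
    have graph: "Map.graph (?p w t) = (\<lambda>j. (g (is ! j) t, w ! j)) ` {..<k}" if "t \<in> space N" for t
    proof -
      have "Map.graph (?p w t) = set (zip (map (\<lambda>i. g i t) is) w)"
        using dist[OF that] lw by (intro graph_map_of_if_distinct_dom) (simp add: k_def)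
      also have "\<dots> = (\<lambda>j. (g (is ! j) t, w ! j)) ` {..<k}"
      proof -
        have "set (zip (map (\<lambda>i. g i t) is) w) = (\<lambda>j. (map (\<lambda>i. g i t) is ! j, w ! j)) ` {..<k}"
          using lw by (auto simp: set_zip k_def simp del: nth_map)
        also have "\<dots> = (\<lambda>j. (g (is ! j) t, w ! j)) ` {..<k}" by (rule image_cong) (auto simp: k_def)
        finally show ?thesis .
      qed
      finally show ?thesis .
    qed
    have "(\<lambda>t. (\<lambda>j. (g (is ! j) t, w ! j)) ` {..<k}) \<in> N \<rightarrow>\<^sub>M finite_subsets (X \<Otimes>\<^sub>M count_space {..<q})"
    proof (rule image_measurable_finite_subsets)
      show "(\<lambda>t. (g (is ! j) t, w ! j)) \<in> N \<rightarrow>\<^sub>M X \<Otimes>\<^sub>M count_space {..<q}" if "j < k" for j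
      proof (rule measurable_Pair[OF g'[OF that]])
        have "w ! j \<in> {..<q}" using lw that nth_mem[of j w] by blast
        then show "(\<lambda>t. w ! j) \<in> N \<rightarrow>\<^sub>M count_space {..<q}" by simp
      qed
    qed (use inj in \<open>auto simp: inj_on_def\<close>)
    then show "(\<lambda>t. Map.graph (?p w t)) \<in> N \<rightarrow>\<^sub>M finite_subsets (X \<Otimes>\<^sub>M count_space {..<q})"
      by (subst measurable_cong[OF graph]) auto
  qed
  have dec: "decode (map (\<lambda>i. g i t) is) Ws = (\<lambda>j. ?p (Ws ! j) t) ` {..<length Ws}" for t
    unfolding decode_def set_conv_nth[of Ws] by auto
  show ?thesis
    unfolding constraint_space_def
  proof (rule measurable_restrict_space2)
    show "(\<lambda>t. decode (map (\<lambda>i. g i t) is) Ws) \<in> N \<rightarrow>\<^sub>M finite_subsets (pfun_space X q)"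
      unfolding dec
    proof (rule image_measurable_finite_subsets)
      show "inj_on (\<lambda>j. ?p (Ws ! j) t) {..<length Ws}" if "t \<in> space N" for t
      proof (rule inj_onI)
        fix i j assume ij: "i \<in> {..<length Ws}" "j \<in> {..<length Ws}" "?p (Ws ! i) t = ?p (Ws ! j) t"
        then have "Ws ! i = Ws ! j"
          using map_of_zip_inj[OF dist[OF that], of "Ws ! i" "Ws ! j"] Ws by (simp add: valid_words_def)
        then show "i = j" using ij Ws by (simp add: valid_words_def nth_eq_iff_index_eq)
      qed
    qed (use p in auto)
    have "decode (map (\<lambda>i. g i t) is) Ws \<in> constraints (space X) q" if t: "t \<in> space N" for t
      unfolding constraints_def
    proof (intro CollectI exI conjI)
      let ?xs = "map (\<lambda>i. g i t) is"
      show "set ?xs \<subseteq> space X" using sp t by auto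
      show "finite (set ?xs)" by simp
      show "decode ?xs Ws \<subseteq> {p. dom p = set ?xs \<and> ran p \<subseteq> {..<q}}"
      proof
        fix p' assume p': "p' \<in> decode ?xs Ws"
        then obtain w where w: "w \<in> set Ws" "p' = ?p w t" by (auto simp: decode_def)
        have "p' \<in> space (pfun_space X q)" using measurable_space[OF p[OF w(1)] t] w(2) by simp
        then show "p' \<in> {p. dom p = set ?xs \<and> ran p \<subseteq> {..<q}}"
          using dom_decode[OF p'] Ws by (simp add: pfun_space_def)
      qed
    qed
    then show "(\<lambda>t. decode (map (\<lambda>i. g i t) is) Ws) \<in> space N \<rightarrow> constraints (space X) q" by auto
  qed
qed

lemma decode_surjective:
  assumes B: "B \<in> constraints X q" and xs: "distinct xs" "set xs = cdom B"
  shows "\<exists>Ws. valid_words q (length xs) Ws \<and> B = decode xs Ws"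
proof -
  note BD = constraintsD[OF B]
  have "finite ((\<lambda>p. map (the \<circ> p) xs) ` B)" using BD(1) by simp
  then obtain Ws where Ws: "set Ws = (\<lambda>p. map (the \<circ> p) xs) ` B" "distinct Ws"
    using finite_distinct_list by blast
  have p: "map_of (zip xs (map (the \<circ> p) xs)) = p" if "p \<in> B" for p
  proof
    fix x show "map_of (zip xs (map (the \<circ> p) xs)) x = p x"
    proof -
      have "x \<in> set xs \<longleftrightarrow> p x \<noteq> None" using BD(4)[OF that] xs(2) by (auto simp: dom_def)
      then show ?thesis by (cases "p x") (auto simp: map_of_zip_map)
    qed
  qed
  have "the (p x) < q" if "p \<in> B" "x \<in> set xs" for p x
  proof -
    have "x \<in> dom p" "ran p \<subseteq> {..<q}" using BD(4,5)[OF that(1)] that(2) xs(2) by auto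
    then show ?thesis by (auto dest: ranI)
  qed
  then have "valid_words q (length xs) Ws" using Ws by (auto simp: valid_words_def)
  moreover have "B = decode xs Ws" unfolding decode_def Ws(1) image_image using p by simp
  ultimately show ?thesis by blast
qed

text \<open>
  The conditional probability expressed without the points: once the code of a constraint is fixed, a
  bound on it becomes a condition on finitely many values of the partial assignment.
\<close>

definition word_prob :: "nat \<Rightarrow> nat list list \<Rightarrow> nat option list \<Rightarrow> real" where
  "word_prob q Ws v =
     real (card {w \<in> set Ws. \<forall>j<length v. v ! j \<noteq> None \<longrightarrow> v ! j = Some (w ! j)}) /
     real q ^ card {j. j < length v \<and> v ! j = None}"

lemma partial_prob_decode:
  assumes xs: "distinct xs" and Ws: "valid_words q (length xs) Ws" "Ws \<noteq> []"
  shows "partial_prob q (decode xs Ws) g = word_prob q Ws (map g xs)"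
proof -
  let ?p = "\<lambda>w. map_of (zip xs w)"
  have c: "cdom (decode xs Ws) = set xs" by (rule cdom_decode[OF Ws])
  have len: "length w = length xs" if "w \<in> set Ws" for w using Ws(1) that by (simp add: valid_words_def)
  have "(\<forall>x\<in>dom g \<inter> set xs. ?p w x = g x) \<longleftrightarrow>
      (\<forall>j<length xs. g (xs ! j) \<noteq> None \<longrightarrow> g (xs ! j) = Some (w ! j))" if "w \<in> set Ws" for w
  proof -
    have "(\<forall>x\<in>dom g \<inter> set xs. ?p w x = g x) \<longleftrightarrow>
        (\<forall>j<length xs. g (xs ! j) \<noteq> None \<longrightarrow> ?p w (xs ! j) = g (xs ! j))"
      unfolding set_conv_nth by auto
    moreover have "?p w (xs ! j) = g (xs ! j) \<longleftrightarrow> g (xs ! j) = Some (w ! j)" if "j < length xs" for j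
      using map_of_zip_nth[OF len[OF \<open>w \<in> set Ws\<close>, symmetric] xs] len[OF \<open>w \<in> set Ws\<close>] that by auto
    ultimately show ?thesis by blast
  qed
  then have "{p \<in> decode xs Ws. \<forall>x\<in>dom g \<inter> set xs. p x = g x} =
      ?p ` {w \<in> set Ws. \<forall>j<length xs. g (xs ! j) \<noteq> None \<longrightarrow> g (xs ! j) = Some (w ! j)}"
    unfolding decode_def by blast
  moreover have "inj_on ?p (set Ws)"
    using map_of_zip_inj[OF xs] len by (auto intro: inj_onI)
  ultimately have 1: "card {p \<in> decode xs Ws. \<forall>x\<in>dom g \<inter> set xs. p x = g x} =
      card {w \<in> set Ws. \<forall>j<length xs. g (xs ! j) \<noteq> None \<longrightarrow> g (xs ! j) = Some (w ! j)}"
    by (simp only:) (rule card_image, auto intro: inj_on_subset)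
  have "set xs - dom g = (\<lambda>j. xs ! j) ` {j. j < length xs \<and> g (xs ! j) = None}"
    by (auto simp: set_conv_nth dom_def)
  moreover have "inj_on (\<lambda>j. xs ! j) {j. j < length xs \<and> g (xs ! j) = None}"
    using xs by (auto simp: inj_on_def nth_eq_iff_index_eq)
  ultimately have 2: "card (set xs - dom g) = card {j. j < length xs \<and> g (xs ! j) = None}"
    by (simp only: card_image)
  have 3: "{w \<in> set Ws. \<forall>j<length (map g xs). map g xs ! j \<noteq> None \<longrightarrow> map g xs ! j = Some (w ! j)} =
      {w \<in> set Ws. \<forall>j<length xs. g (xs ! j) \<noteq> None \<longrightarrow> g (xs ! j) = Some (w ! j)}" by auto
  have 4: "{j. j < length (map g xs) \<and> map g xs ! j = None} = {j. j < length xs \<and> g (xs ! j) = None}" by auto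
  show ?thesis unfolding partial_prob_def word_prob_def c 1 2 3 4 ..
qed

section \<open>Measurable extension of partial assignments\<close>

text \<open>
  The functions \<open>f i\<close> enumerate, for each point, the point and its neighbours in the graph of the
  constraint satisfaction problem. All later measurability proofs consist of composing with these
  functions and taking countable unions, so that no further projection is needed.
\<close>

locale enumerated_csp = sparse_csp "space X" q d \<B>
  for X :: "'a measure" and q d :: nat and \<B> :: "'a constraint set" +
  fixes f :: "nat \<Rightarrow> 'a \<Rightarrow> 'a"
  assumes standard: "standard_borel X" and borel: "borel_csp X q \<B>"
    and f_measurable: "\<And>i. f i \<in> univ_completion X \<rightarrow>\<^sub>M univ_completion X"
    and f_range: "\<And>x. x \<in> space X \<Longrightarrow> range (\<lambda>i. f i x) = insert x {y. (x, y) \<in> snd (csp_graph (space X) \<B>)}"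
begin

abbreviation U :: "'a measure" where "U \<equiv> univ_completion X"

abbreviation adj :: "('a \<times> 'a) set" where "adj \<equiv> snd (csp_graph (space X) \<B>)"

lemma measurable_U_X: "g \<in> U \<rightarrow>\<^sub>M U \<Longrightarrow> g \<in> U \<rightarrow>\<^sub>M X"
  using sets_subset_sets_univ_completion[of X] measurable_space[of g U U] measurable_sets[of g U U]
  by (intro measurableI) auto

lemma adjI: "\<lbrakk>B \<in> \<B>; x \<in> cdom B; y \<in> cdom B; x \<noteq> y\<rbrakk> \<Longrightarrow> (x, y) \<in> adj"
  using constraints constraintsD(3)[of B "space X" q] by (auto simp: csp_graph_def)

lemma sym_adj: "sym adj"
  by (auto simp: csp_graph_def sym_def)

lemma adj_subset: "adj \<subseteq> space X \<times> space X"
  by (auto simp: csp_graph_def)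

lemma ex_f:
  assumes "B \<in> \<B>" "x \<in> cdom B" "y \<in> cdom B"
  shows "\<exists>i. f i x = y"
proof -
  have "x \<in> space X" using assms constraints constraintsD(3)[of B "space X" q] by auto
  then have "y \<in> range (\<lambda>i. f i x)" using adjI[OF assms] by (auto simp: f_range)
  then show ?thesis by auto
qed

lemma pred_eq:
  assumes g: "g \<in> U \<rightarrow>\<^sub>M X" and h: "h \<in> U \<rightarrow>\<^sub>M X"
  shows "Measurable.pred U (\<lambda>x. g x = h x)"
proof -
  obtain V :: "nat \<Rightarrow> 'a set" where V: "\<And>n. V n \<in> sets X"
    "\<And>F y. finite F \<Longrightarrow> F \<subseteq> space X \<Longrightarrow> y \<in> F \<Longrightarrow> \<exists>n. V n \<inter> F = {y}"
    using countable_isolating_family[OF standard] by blast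
  note [measurable] = g h V(1)
  have *: "g x = h x \<longleftrightarrow> (\<forall>n. g x \<in> V n \<longleftrightarrow> h x \<in> V n)" if x: "x \<in> space U" for x
  proof
    assume eq: "\<forall>n. g x \<in> V n \<longleftrightarrow> h x \<in> V n"
    obtain n where "V n \<inter> {g x, h x} = {g x}"
      using V(2)[of "{g x, h x}" "g x"] measurable_space[OF g x] measurable_space[OF h x] by auto
    then have only: "y = g x" if "y \<in> V n" "y \<in> {g x, h x}" for y using that by auto
    have "g x \<in> V n" using \<open>V n \<inter> {g x, h x} = {g x}\<close> by auto
    then have "h x \<in> V n" using eq by blast
    then show "g x = h x" using only[of "h x"] by simp
  qed simp
  have "Measurable.pred U (\<lambda>x. \<forall>n. g x \<in> V n \<longleftrightarrow> h x \<in> V n)" by measurable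
  then show ?thesis by (subst measurable_cong[OF *])
qed

lemma decode_in_csp_measurable:
  assumes Ws: "valid_words q (length is) Ws"
  shows "{x \<in> space X. distinct (map (\<lambda>i. f i x) is) \<and> decode (map (\<lambda>i. f i x) is) Ws \<in> \<B>} \<in> sets U"
proof -
  define D where "D = {x \<in> space X. distinct (map (\<lambda>i. f i x) is)}"
  have [measurable]: "Measurable.pred U (\<lambda>x. f i x = f j x)" for i j
    by (intro pred_eq measurable_U_X f_measurable)
  have "Measurable.pred U (\<lambda>x. \<forall>i. i < length is \<longrightarrow> (\<forall>j. j < length is \<longrightarrow> i \<noteq> j \<longrightarrow> f (is ! i) x \<noteq> f (is ! j) x))"
    by measurable
  then have "{x \<in> space U. \<forall>i. i < length is \<longrightarrow> (\<forall>j. j < length is \<longrightarrow> i \<noteq> j \<longrightarrow> f (is ! i) x \<noteq> f (is ! j) x)} \<in> sets U"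
    by (simp only: pred_def)
  also have "{x \<in> space U. \<forall>i. i < length is \<longrightarrow> (\<forall>j. j < length is \<longrightarrow> i \<noteq> j \<longrightarrow> f (is ! i) x \<noteq> f (is ! j) x)} = D"
    by (auto simp: D_def distinct_conv_nth)
  finally have D: "D \<in> sets U" .
  let ?N = "restrict_space U D"
  have spN: "space ?N = D" by (auto simp: space_restrict_space D_def)
  have "(\<lambda>x. decode (map (\<lambda>i. f i x) is) Ws) \<in> ?N \<rightarrow>\<^sub>M constraint_space X q"
  proof (rule decode_measurable[OF _ _ Ws])
    show "f i \<in> ?N \<rightarrow>\<^sub>M X" for i by (intro measurable_restrict_space1 measurable_U_X f_measurable)
    show "distinct (map (\<lambda>i. f i x) is)" if "x \<in> space ?N" for x using that unfolding spN by (simp add: D_def)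
  qed
  from measurable_sets[OF this borel[unfolded borel_csp_def]]
  have "(\<lambda>x. decode (map (\<lambda>i. f i x) is) Ws) -` \<B> \<inter> D \<in> sets ?N" by (simp add: spN)
  then have "(\<lambda>x. decode (map (\<lambda>i. f i x) is) Ws) -` \<B> \<inter> D \<in> sets U"
    using D by (auto simp: sets_restrict_space)
  also have "(\<lambda>x. decode (map (\<lambda>i. f i x) is) Ws) -` \<B> \<inter> D =
      {x \<in> space X. distinct (map (\<lambda>i. f i x) is) \<and> decode (map (\<lambda>i. f i x) is) Ws \<in> \<B>}"
    by (auto simp: D_def)
  finally show ?thesis .
qed

lemma pred_map_eq:
  assumes g: "g \<in> U \<rightarrow>\<^sub>M count_space (UNIV :: nat option set)"
  shows "Measurable.pred U (\<lambda>x. map (\<lambda>i. g (f i x)) is = v)"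
proof (induction "is" arbitrary: v)
  case (Cons i "is")
  have [measurable]: "(\<lambda>x. g (f i x)) \<in> U \<rightarrow>\<^sub>M count_space UNIV"
    by (rule measurable_compose[OF f_measurable g])
  show ?case
  proof (cases v)
    case (Cons a v')
    note [measurable] = Cons.IH[of v']
    have "Measurable.pred U (\<lambda>x. g (f i x) = a \<and> map (\<lambda>i. g (f i x)) is = v')" by measurable
    then show ?thesis by (simp add: Cons)
  qed simp
qed simp

text \<open>
  A constraint at \<open>x\<close> has only neighbours of \<open>x\<close> in its domain, so it is described by a list of indices
  of the enumeration \<open>f\<close> and a list of words. There are countably many such codes, and that a given
  code describes a member of \<open>\<B>\<close> is a measurable condition on \<open>x\<close>.
\<close>

lemma large_partial_prob_measurable:
  assumes g: "g \<in> U \<rightarrow>\<^sub>M count_space UNIV"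
  shows "{x \<in> space X. \<exists>B\<in>\<B>. x \<in> cdom B \<and> \<theta> \<le> partial_prob q B g} \<in> sets U"
proof -
  define I where "I = {(is :: nat list, Ws, v, i). valid_words q (length is) Ws \<and> Ws \<noteq> [] \<and> i \<in> set is \<and> \<theta> \<le> word_prob q Ws v}"
  define S where "S = (\<lambda>(is, Ws, v, i).
    {x \<in> space X. distinct (map (\<lambda>i. f i x) is) \<and> decode (map (\<lambda>i. f i x) is) Ws \<in> \<B>} \<inter>
    {x \<in> space X. f i x = x} \<inter> {x \<in> space X. map (\<lambda>i. g (f i x)) is = v})"
  have "S c \<in> sets U" if "c \<in> I" for c
  proof -
    obtain "is" Ws v i where c: "c = (is, Ws, v, i)" by (cases c)
    have "Measurable.pred U (\<lambda>x. f i x = x)"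
      by (intro pred_eq measurable_U_X f_measurable) simp
    then have "{x \<in> space X. f i x = x} \<in> sets U" by (simp add: pred_def)
    moreover have "{x \<in> space X. map (\<lambda>i. g (f i x)) is = v} \<in> sets U"
      using pred_map_eq[OF g, of "is" v] by (simp add: pred_def)
    ultimately show ?thesis
      using that decode_in_csp_measurable[of "is" Ws] by (auto simp: c S_def I_def intro!: sets.Int)
  qed
  then have "(\<Union>c\<in>I. S c) \<in> sets U" by (intro sets.countable_UN'') auto
  also have "(\<Union>c\<in>I. S c) = {x \<in> space X. \<exists>B\<in>\<B>. x \<in> cdom B \<and> \<theta> \<le> partial_prob q B g}"
  proof (intro equalityI subsetI)
    fix x assume "x \<in> (\<Union>c\<in>I. S c)"
    then obtain "is" Ws v i where c: "(is, Ws, v, i) \<in> I" "x \<in> S (is, Ws, v, i)" by auto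
    let ?xs = "map (\<lambda>i. f i x) is"
    have x: "x \<in> space X" "distinct ?xs" "decode ?xs Ws \<in> \<B>" "f i x = x" "map g ?xs = v"
      using c(2) by (auto simp: S_def comp_def)
    have W: "valid_words q (length ?xs) Ws" "Ws \<noteq> []" "i \<in> set is" "\<theta> \<le> word_prob q Ws v"
      using c(1) by (auto simp: I_def)
    have "x \<in> cdom (decode ?xs Ws)"
      unfolding cdom_decode[OF W(1,2)] using W(3) x(4) by force
    moreover have "\<theta> \<le> partial_prob q (decode ?xs Ws) g"
      using partial_prob_decode[OF x(2) W(1,2), of g] W(4) x(5) by simp
    ultimately show "x \<in> {x \<in> space X. \<exists>B\<in>\<B>. x \<in> cdom B \<and> \<theta> \<le> partial_prob q B g}" using x by blast
  next
    fix x assume "x \<in> {x \<in> space X. \<exists>B\<in>\<B>. x \<in> cdom B \<and> \<theta> \<le> partial_prob q B g}"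
    then obtain B where x: "x \<in> space X" and B: "B \<in> \<B>" "x \<in> cdom B" "\<theta> \<le> partial_prob q B g" by blast
    have Bc: "B \<in> constraints (space X) q" using B constraints by auto
    obtain xs where xs: "distinct xs" "set xs = cdom B"
      using finite_distinct_list[OF constraintsD(2)[OF Bc]] by blast
    obtain Ws where Ws: "valid_words q (length xs) Ws" "B = decode xs Ws"
      using decode_surjective[OF Bc xs] by blast
    have "Ws \<noteq> []" using B(2) Ws(2) by (auto simp: decode_def cdom_def)
    have "\<forall>y\<in>set xs. \<exists>i. f i x = y" using ex_f[OF B(1,2)] xs(2) by blast
    then obtain k where k: "\<And>y. y \<in> set xs \<Longrightarrow> f (k y) x = y" by metis
    define "is" where "is = map k xs"
    have "map (\<lambda>i. f i x) is = map (\<lambda>y. y) xs" unfolding is_def map_map by (rule map_cong) (auto simp: k)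
    then have is_xs: "map (\<lambda>i. f i x) is = xs" by simp
    have "(is, Ws, map g xs, k x) \<in> I"
      using Ws \<open>Ws \<noteq> []\<close> xs B(2,3) partial_prob_decode[OF xs(1) Ws(1) \<open>Ws \<noteq> []\<close>, of g]
      by (auto simp: I_def is_def)
    moreover have "x \<in> S (is, Ws, map g xs, k x)"
    proof -
      have "map (\<lambda>i. g (f i x)) is = map g (map (\<lambda>i. f i x) is)" by simp
      then have "map (\<lambda>i. g (f i x)) is = map g xs" by (simp only: is_xs)
      moreover have "f (k x) x = x" using k xs(2) B(2) by simp
      ultimately show ?thesis using x xs(1) B(1) unfolding S_def Ws(2) by (simp add: is_xs)
    qed
    ultimately show "x \<in> (\<Union>c\<in>I. S c)" by blast
  qed
  finally show ?thesis .
qed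

lemma countable_family_realizing_finite_functions:
  "\<exists>F::nat \<Rightarrow> 'a \<Rightarrow> nat. (\<forall>n. F n \<in> U \<rightarrow>\<^sub>M count_space UNIV) \<and> (\<forall>n x. F n x < q) \<and>
     (\<forall>K h. finite K \<longrightarrow> K \<subseteq> space X \<longrightarrow> h \<in> K \<rightarrow> {..<q} \<longrightarrow> (\<exists>n. \<forall>y\<in>K. F n y = h y))"
proof -
  obtain V :: "nat \<Rightarrow> 'a set" where V: "\<And>n. V n \<in> sets X"
    "\<And>F y. finite F \<Longrightarrow> F \<subseteq> space X \<Longrightarrow> y \<in> F \<Longrightarrow> \<exists>n. V n \<inter> F = {y}"
    using countable_isolating_family[OF standard] by blast
  define c :: "(nat \<times> nat) list \<Rightarrow> 'a \<Rightarrow> nat" where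
    "c l x = foldr (\<lambda>(n, v) r. if x \<in> V n \<and> v < q then v else r) l 0" for l x
  have c_simps: "c [] x = 0" "c (a # l) x = (if x \<in> V (fst a) \<and> snd a < q then snd a else c l x)" for a l x
    by (auto simp: c_def case_prod_unfold)
  have [measurable]: "Measurable.pred U (\<lambda>x. x \<in> V n)" for n
    using V(1)[of n] sets_subset_sets_univ_completion[of X] sets.sets_into_space[OF V(1)[of n]]
    by (auto simp: pred_def Int_def[symmetric] Int_absorb1 conj_commute cong: conj_cong)
  have c_meas: "c l \<in> U \<rightarrow>\<^sub>M count_space UNIV" for l
  proof (induction l)
    case (Cons a l)
    note [measurable] = Cons
    have "(\<lambda>x. if x \<in> V (fst a) \<and> snd a < q then snd a else c l x) \<in> U \<rightarrow>\<^sub>M count_space UNIV" by measurable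
    then show ?case by (simp add: c_simps cong: measurable_cong)
  qed (simp add: c_simps cong: measurable_cong)
  have c_less: "c l x < q" for l x by (induction l) (auto simp: c_simps q_pos)
  have "\<exists>l. \<forall>y\<in>K. c l y = h y" if K: "finite K" "K \<subseteq> space X" and h: "h \<in> K \<rightarrow> {..<q}" for K h
  proof -
    have "\<forall>y\<in>K. \<exists>n. V n \<inter> K = {y}" using V(2)[OF K] by blast
    then obtain k where k: "\<And>y. y \<in> K \<Longrightarrow> V (k y) \<inter> K = {y}" by metis
    obtain ys where ys: "set ys = K" using finite_list[OF K(1)] by blast
    have "c (map (\<lambda>y. (k y, h y)) zs) x = h x" if "set zs \<subseteq> K" "x \<in> set zs" for zs x
      using that
    proof (induction zs)
      case (Cons z zs)
      have "x \<in> V (k z) \<longleftrightarrow> x = z" using k[of z] Cons.prems by auto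
      moreover have "h z < q" using h Cons.prems by auto
      ultimately show ?case using Cons by (auto simp: c_simps)
    qed simp
    then show ?thesis using ys by (intro exI[of _ "map (\<lambda>y. (k y, h y)) ys"]) auto
  qed
  then have "\<exists>n. \<forall>y\<in>K. c (from_nat n) y = h y" if "finite K" "K \<subseteq> space X" "h \<in> K \<rightarrow> {..<q}" for K h
    using that by (metis from_nat_to_nat)
  then show ?thesis using c_meas c_less by (intro exI[of _ "\<lambda>n. c (from_nat n)"]) auto
qed

text \<open>The set is reached from \<open>A\<close> by countably many steps to neighbours in \<open>W\<close>.\<close>

lemma saturation_measurable:
  assumes W: "W \<in> sets U" and A: "A \<in> sets U" "A \<subseteq> W"
  shows "{x \<in> W. \<exists>y\<in>A. (x, y) \<in> (adj \<inter> W \<times> W)\<^sup>*} \<in> sets U"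
proof -
  let ?R = "adj \<inter> W \<times> W"
  have Wsp: "W \<subseteq> space X" using sets.sets_into_space[OF W] by simp
  define st where "st S = W \<inter> (\<Union>i. f i -` S \<inter> space X)" for S
  have mem_st: "x \<in> st S \<longleftrightarrow> x \<in> W \<and> (\<exists>i. f i x \<in> S)" for x S using Wsp by (auto simp: st_def)
  have st_sets: "st S \<in> sets U" if "S \<in> sets U" for S
  proof -
    have "f i -` S \<inter> space X \<in> sets U" for i using measurable_sets[OF f_measurable that, of i] by simp
    then show ?thesis unfolding st_def using W by (intro sets.Int sets.countable_UN) auto
  qed
  have m: "(st ^^ k) A \<in> sets U" for k
  proof (induction k)
    case (Suc k)
    then show ?case using st_sets by simp
  qed (use A in simp)
  have sub: "(st ^^ k) A \<subseteq> W" for k using A(2) by (cases k) (auto simp: mem_st)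
  have "{x \<in> W. \<exists>y\<in>A. (x, y) \<in> ?R\<^sup>*} = (\<Union>k. (st ^^ k) A)"
  proof (intro equalityI subsetI)
    fix x assume "x \<in> {x \<in> W. \<exists>y\<in>A. (x, y) \<in> ?R\<^sup>*}"
    then obtain y where "y \<in> A" "(x, y) \<in> ?R\<^sup>*" by blast
    from this(2) show "x \<in> (\<Union>k. (st ^^ k) A)"
    proof (induction rule: converse_rtrancl_induct)
      case base
      show ?case using \<open>y \<in> A\<close> by (intro UN_I[of 0]) auto
    next
      case (step x z)
      then obtain k where k: "z \<in> (st ^^ k) A" by blast
      have "x \<in> space X" using step Wsp by auto
      then have "z \<in> range (\<lambda>i. f i x)" using step by (simp add: f_range)
      then have "x \<in> (st ^^ Suc k) A" using k step by (auto simp: mem_st)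
      then show ?case by blast
    qed
  next
    fix x assume "x \<in> (\<Union>k. (st ^^ k) A)"
    then obtain k where "x \<in> (st ^^ k) A" by blast
    then show "x \<in> {x \<in> W. \<exists>y\<in>A. (x, y) \<in> ?R\<^sup>*}"
    proof (induction k arbitrary: x)
      case 0
      then show ?case using A(2) by auto
    next
      case (Suc k)
      then obtain i where i: "x \<in> W" "f i x \<in> (st ^^ k) A" by (auto simp: mem_st)
      from Suc.IH[OF i(2)] obtain y where y: "y \<in> A" "(f i x, y) \<in> ?R\<^sup>*" by blast
      have "f i x = x \<or> (x, f i x) \<in> adj" using f_range[of x] i(1) Wsp by auto
      then have "(x, f i x) \<in> ?R\<^sup>*" using i sub[of k] by auto
      then show ?case using i(1) y by (auto intro: rtrancl_trans)
    qed
  qed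
  then show ?thesis using m by auto
qed

text \<open>
  On each finite component the extension exists by the local lemma. The choice is made measurable by
  taking, on each component, the first good function from a countable family of global functions that
  realizes every function on every finite set.
\<close>

lemma measurable_extension:
  assumes g: "g \<in> U \<rightarrow>\<^sub>M count_space UNIV" "ran g \<subseteq> {..<q}" and W: "W \<in> sets U" "W \<inter> dom g = {}"
    and comp: "\<And>x. x \<in> W \<Longrightarrow> finite {y. (x, y) \<in> (adj \<inter> W \<times> W)\<^sup>*}"
    and s: "s > 0" "\<And>B. B \<in> \<B> \<Longrightarrow> partial_prob q B g \<le> s"
  shows "\<exists>g'. g' \<in> U \<rightarrow>\<^sub>M count_space UNIV \<and> ran g' \<subseteq> {..<q} \<and> dom g' = dom g \<union> W \<and>
    (\<forall>B\<in>\<B>. partial_prob q B g' < s * (exp 1 * (real d + 1)))"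
proof -
  let ?R = "adj \<inter> W \<times> W" and ?t = "s * (exp 1 * (real d + 1))"
  have Wsp: "W \<subseteq> space X" using sets.sets_into_space[OF W(1)] by simp
  have symR: "sym (?R\<^sup>*)" using sym_adj by (intro sym_rtrancl) (auto simp: sym_def)
  have predW[measurable]: "Measurable.pred U (\<lambda>x. x \<in> W)" using W(1) by measurable
  obtain F :: "nat \<Rightarrow> 'a \<Rightarrow> nat" where F[measurable]: "\<And>n. F n \<in> U \<rightarrow>\<^sub>M count_space UNIV"
    and Fq: "\<And>n x. F n x < q"
    and F_all: "\<And>K h. finite K \<Longrightarrow> K \<subseteq> space X \<Longrightarrow> h \<in> K \<rightarrow> {..<q} \<Longrightarrow> \<exists>n. \<forall>y\<in>K. F n y = h y"
    using countable_family_realizing_finite_functions by metis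
  note [measurable] = g(1)
  have "(\<lambda>x. if x \<in> W then Some (F n x) else g x) \<in> U \<rightarrow>\<^sub>M count_space UNIV" for n by measurable
  then have G: "extend g W (F n) \<in> U \<rightarrow>\<^sub>M count_space UNIV" for n
    by (simp add: extend_def[abs_def])
  define bad where "bad n = {x \<in> space X. \<exists>B\<in>\<B>. x \<in> cdom B \<and> ?t \<le> partial_prob q B (extend g W (F n))} \<inter> W" for n
  have bad: "bad n \<in> sets U" for n
    unfolding bad_def using large_partial_prob_measurable[OF G] W(1) by (rule sets.Int)
  define sat where "sat n = {x \<in> W. \<exists>y\<in>bad n. (x, y) \<in> ?R\<^sup>*}" for n
  have sat: "sat n \<in> sets U" for n
    unfolding sat_def using W(1) bad by (rule saturation_measurable) (auto simp: bad_def)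
  have [measurable]: "Measurable.pred U (\<lambda>x. x \<in> sat n)" for n using sat[of n] by measurable
  define N where "N x = (LEAST n. x \<notin> sat n)" for x
  have N[measurable]: "N \<in> U \<rightarrow>\<^sub>M count_space UNIV" unfolding N_def by measurable
  define g' where "g' = extend g W (\<lambda>x. F (N x) x)"
  have "(\<lambda>x. F (N x) x) \<in> U \<rightarrow>\<^sub>M count_space UNIV" by (rule measurable_compose_countable[OF F N])
  then have "(\<lambda>x. if x \<in> W then Some (F (N x) x) else g x) \<in> U \<rightarrow>\<^sub>M count_space UNIV" by measurable
  then have g'_meas: "g' \<in> U \<rightarrow>\<^sub>M count_space UNIV" by (simp add: g'_def extend_def[abs_def])
  have "\<exists>n. x \<notin> sat n" if x: "x \<in> W" for x
  proof -
    define K where "K = {y. (x, y) \<in> ?R\<^sup>*}"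
    have KW: "K \<subseteq> W"
    proof
      fix y assume "y \<in> K"
      then have "(x, y) \<in> ?R\<^sup>*" by (simp add: K_def)
      then show "y \<in> W" using x by (induction) auto
    qed
    have K: "finite K" "K \<inter> dom g = {}" using comp[OF x] KW W(2) by (auto simp: K_def)
    define \<A> where "\<A> = (\<Union>y\<in>K. {B \<in> \<B>. y \<in> cdom B})"
    have "finite \<A>" "\<A> \<subseteq> \<B>" using K(1) finite_constraints_at by (auto simp: \<A>_def)
    from extend_partial_assignment[OF q_pos constraints nbrs this K s(1)] s(2) \<open>\<A> \<subseteq> \<B>\<close>
    obtain h where h: "h \<in> K \<rightarrow>\<^sub>E {..<q}" "\<And>B. B \<in> \<A> \<Longrightarrow> partial_prob q B (extend g K h) < ?t" by blast
    obtain n where n: "\<And>y. y \<in> K \<Longrightarrow> F n y = h y" using F_all[OF K(1), of h] KW Wsp h(1) by blast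
    have "y \<notin> bad n" if y: "y \<in> K" for y
    proof
      assume "y \<in> bad n"
      then obtain B where B: "B \<in> \<B>" "y \<in> cdom B" "?t \<le> partial_prob q B (extend g W (F n))"
        by (auto simp: bad_def)
      have "z \<in> K \<longleftrightarrow> z \<in> W" if "z \<in> cdom B" for z
      proof
        assume "z \<in> W"
        then have "z = y \<or> (y, z) \<in> ?R" using adjI[OF B(1,2) that] KW y by auto
        then show "z \<in> K" using y unfolding K_def by (auto intro: rtrancl_into_rtrancl)
      qed (use KW in auto)
      then have "partial_prob q B (extend g W (F n)) = partial_prob q B (extend g K h)"
        using n by (intro partial_prob_cong) (auto simp: extend_def)
      moreover have "B \<in> \<A>" using B y by (auto simp: \<A>_def)
      ultimately show False using h(2)[of B] B(3) by simp
    qed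
    then show ?thesis by (auto simp: sat_def K_def intro: exI[of _ n])
  qed
  then have N_sat: "x \<notin> sat (N x)" if "x \<in> W" for x unfolding N_def using that by (metis LeastI)
  have "partial_prob q B g' < ?t" if B: "B \<in> \<B>" for B
  proof (cases "cdom B \<inter> W = {}")
    case True
    then have "partial_prob q B g' = partial_prob q B g"
      by (intro partial_prob_cong) (auto simp: g'_def extend_def)
    also have "\<dots> \<le> s" using s(2)[OF B] .
    also have "s < ?t"
    proof -
      have "1 * 1 < exp 1 * (real d + 1)" by (rule mult_less_le_imp_less) auto
      then show ?thesis using s(1) by simp
    qed
    finally show ?thesis .
  next
    case False
    then obtain x where x: "x \<in> cdom B" "x \<in> W" by blast
    have "N y = N x" if y: "y \<in> cdom B" "y \<in> W" for y
    proof -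
      have xy: "(x, y) \<in> ?R\<^sup>*"
        using adjI[OF B x(1) y(1)] x(2) y(2) by (cases "x = y") auto
      have yx: "(y, x) \<in> ?R\<^sup>*" using symD[OF symR xy] .
      have "y \<in> sat n \<longleftrightarrow> x \<in> sat n" for n
        using x(2) y(2) xy yx unfolding sat_def by (auto intro: rtrancl_trans)
      then show ?thesis by (simp add: N_def)
    qed
    then have "partial_prob q B g' = partial_prob q B (extend g W (F (N x)))"
      by (intro partial_prob_cong) (auto simp: g'_def extend_def)
    moreover have "x \<notin> bad (N x)" using N_sat[OF x(2)] x(2) unfolding sat_def by blast
    then have "\<not> ?t \<le> partial_prob q B (extend g W (F (N x)))"
      using x B Wsp unfolding bad_def by blast
    ultimately show ?thesis by simp
  qed
  moreover have "ran g' \<subseteq> {..<q}"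
    using g(2) Fq by (auto simp: g'_def extend_def ran_def split: if_splits)
  ultimately show ?thesis using g'_meas by (intro exI[of _ g']) (auto simp: g'_def)
qed

end

section \<open>Splitting a hyperfinite graph into two parts with finite components\<close>

lemma (in sparse_csp) finite_neighbours: "finite {y. (x, y) \<in> snd (csp_graph X \<B>)}"
proof -
  have "{y. (x, y) \<in> snd (csp_graph X \<B>)} \<subseteq> (\<Union>B\<in>{B \<in> \<B>. x \<in> cdom B}. cdom B)"
    by (auto simp: csp_graph_def)
  moreover have "finite (\<Union>B\<in>{B \<in> \<B>. x \<in> cdom B}. cdom B)"
    using finite_constraints_at[of x] constraints constraintsD(2) by (intro finite_UN_I) auto
  ultimately show ?thesis by (rule finite_subset)
qed

context enumerated_csp
begin

definition nbhd :: "'a set \<Rightarrow> 'a set" where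
  "nbhd S = {x \<in> space X. \<exists>i. f i x \<in> S}"

lemma nbhd_iff: "x \<in> nbhd S \<longleftrightarrow> x \<in> space X \<and> (x \<in> S \<or> (\<exists>y\<in>S. (x, y) \<in> adj))"
proof -
  have "(\<exists>i. f i x \<in> S) \<longleftrightarrow> (\<exists>y\<in>insert x {y. (x, y) \<in> adj}. y \<in> S)" if "x \<in> space X"
    unfolding f_range[OF that, symmetric] by auto
  then show ?thesis by (auto simp: nbhd_def)
qed

lemma nbhd_sets: "S \<in> sets U \<Longrightarrow> nbhd S \<in> sets U"
proof -
  assume S: "S \<in> sets U"
  have "f i -` S \<inter> space X \<in> sets U" for i using measurable_sets[OF f_measurable S, of i] by simp
  moreover have "nbhd S = (\<Union>i. f i -` S \<inter> space X)" by (auto simp: nbhd_def)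
  ultimately show ?thesis by (simp only:) (rule sets.countable_UN, blast)
qed

lemma nbhd_mono: "S \<subseteq> T \<Longrightarrow> nbhd S \<subseteq> nbhd T"
  by (auto simp: nbhd_def)

lemma nbhd_pow_sets: "S \<in> sets U \<Longrightarrow> (nbhd ^^ j) S \<in> sets U"
  by (induction j) (auto intro: nbhd_sets)

lemma nbhd_pow_mono: "S \<subseteq> T \<Longrightarrow> (nbhd ^^ j) S \<subseteq> (nbhd ^^ j) T"
  by (induction j) (simp_all add: nbhd_mono)

lemma nbhd_pow_le:
  assumes "S \<subseteq> space X" "i \<le> j"
  shows "(nbhd ^^ i) S \<subseteq> (nbhd ^^ j) S"
proof -
  have sp: "(nbhd ^^ k) S \<subseteq> space X" for k using assms(1) by (cases k) (auto simp: nbhd_def)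
  have "(nbhd ^^ k) S \<subseteq> (nbhd ^^ Suc k) S" for k using sp[of k] by (auto simp: nbhd_iff)
  then show ?thesis using lift_Suc_mono_le[of "\<lambda>k. (nbhd ^^ k) S"] assms(2) by simp
qed

text \<open>
  Let \<open>A n\<close> be the set of points with an edge outside the \<open>n\<close>-th graph with finite components. These
  sets decrease to the empty set, hence so do their \<open>j\<close>-th neighbourhoods by local finiteness, and
  \<open>N j\<close> can be chosen such that the \<open>j\<close>-th neighbourhood of \<open>A (N j)\<close> has measure below \<open>(1/2) ^ j\<close>.
  Let \<open>C' k\<close> be the union over \<open>i\<close> of the \<open>i\<close>-th neighbourhoods of \<open>A (N (k + i))\<close>. Then
  \<open>C' (Suc k)\<close> and its neighbours lie in \<open>C' k\<close>, so the intersection \<open>Z\<close> of all \<open>C' k\<close> is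
  invariant, and it is null by the Borel-Cantelli lemma. The sequence \<open>C\<close> is \<open>C'\<close> preceded by the
  whole space; outside of \<open>Z\<close>, edges join points of equal or consecutive layers \<open>C k - C (Suc k)\<close>,
  and all edges at points of that layer belong to the \<open>N k\<close>-th graph. So the even layers form one
  part and the odd layers the other: a component of a part stays in one layer and is finite.
\<close>

theorem hyperfinite_split:
  assumes \<mu>: "finite_measure \<mu>" "sets \<mu> = sets X" and hyp: "hyperfinite X (csp_graph (space X) \<B>)"
  shows "\<exists>Z W. Z \<in> null_sets (completion \<mu>) \<and> (\<forall>x\<in>Z. \<forall>y. (x, y) \<in> adj \<longrightarrow> y \<in> Z) \<and>
    (\<forall>b::bool. W b \<in> sets U) \<and> W True \<inter> W False = {} \<and> W True \<union> W False = space X - Z \<and>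
    (\<forall>b. \<forall>x\<in>W b. finite {y. (x, y) \<in> (adj \<inter> W b \<times> W b)\<^sup>*})"
proof -
  have adj_sets: "adj \<in> sets (X \<Otimes>\<^sub>M X)" using hyp by (simp add: hyperfinite_def borel_graph_def)
  obtain H :: "nat \<Rightarrow> 'a ugraph" where
    H0: "\<forall>n. borel_graph X (H n) \<and> finite_components (H n) \<and> subgraph (H n) (H (Suc n)) \<and>
      subgraph (H n) (csp_graph (space X) \<B>)" and H1: "(\<Union>n. snd (H n)) = adj"
    using hyp unfolding hyperfinite_def by (elim conjE exE) (rule that, assumption+)
  have H: "\<And>n. borel_graph X (H n)" "\<And>n. finite_components (H n)" "\<And>n. subgraph (H n) (H (Suc n))"
    using H0 by simp_all
  have "snd (H n) \<subseteq> snd (H (Suc n))" for n using H(3)[of n] by (simp add: subgraph_def)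
  then have mono_H: "snd (H m) \<subseteq> snd (H n)" if "m \<le> n" for m n
    using lift_Suc_mono_le[of "\<lambda>n. snd (H n)" m n] that by simp
  have fin_H: "finite {y. (x, y) \<in> (snd (H n))\<^sup>*}" for n x
  proof (cases "x \<in> fst (H n)")
    case True
    then show ?thesis using H(2)[of n] by (simp add: finite_components_def)
  next
    case False
    have "y = x" if "(x, y) \<in> (snd (H n))\<^sup>*" for y
      using that H(1)[of n] False by (cases rule: converse_rtranclE) (auto simp: borel_graph_def)
    then have "{y. (x, y) \<in> (snd (H n))\<^sup>*} \<subseteq> {x}" by blast
    then show ?thesis by (rule finite_subset) simp
  qed
  define A where "A n = {x \<in> space X. \<exists>y. (x, y) \<in> adj - snd (H n)}" for n
  have A_sp: "A n \<subseteq> space X" for n by (auto simp: A_def)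
  have A_sets: "A n \<in> sets U" for n
  proof -
    have [measurable]: "f i \<in> U \<rightarrow>\<^sub>M X" for i by (intro measurable_U_X f_measurable)
    have idX: "(\<lambda>x. x) \<in> U \<rightarrow>\<^sub>M X" by (rule measurable_U_X) simp
    have "(\<lambda>x. (x, f i x)) \<in> U \<rightarrow>\<^sub>M X \<Otimes>\<^sub>M X" for i by (rule measurable_Pair[OF idX]) measurable
    moreover have "adj - snd (H n) \<in> sets (X \<Otimes>\<^sub>M X)"
      using adj_sets H(1)[of n] by (auto simp: borel_graph_def)
    ultimately have "(\<lambda>x. (x, f i x)) -` (adj - snd (H n)) \<inter> space U \<in> sets U" for i
      by (rule measurable_sets)
    then have "(\<Union>i. (\<lambda>x. (x, f i x)) -` (adj - snd (H n)) \<inter> space U) \<in> sets U"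
      by (intro sets.countable_UN image_subsetI)
    also have "(\<Union>i. (\<lambda>x. (x, f i x)) -` (adj - snd (H n)) \<inter> space U) = A n"
    proof -
      have "\<exists>i. f i x = y" if "x \<in> space X" "(x, y) \<in> adj" for x y
      proof -
        have "y \<in> range (\<lambda>i. f i x)" using that by (simp add: f_range)
        then show ?thesis by auto
      qed
      then show ?thesis unfolding A_def by fastforce
    qed
    finally show ?thesis .
  qed
  have A_dec: "A n \<subseteq> A m" if "m \<le> n" for m n using mono_H[OF that] by (auto simp: A_def)
  have A_ev: "eventually (\<lambda>n. x \<notin> A n) sequentially" for x
  proof -
    have "eventually (\<lambda>n. \<forall>y\<in>{y. (x, y) \<in> adj}. (x, y) \<in> snd (H n)) sequentially"
    proof (rule eventually_ball_finite[OF finite_neighbours], rule ballI)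
      fix y assume "y \<in> {y. (x, y) \<in> adj}"
      then obtain m where "(x, y) \<in> snd (H m)" using H1 by blast
      then show "eventually (\<lambda>n. (x, y) \<in> snd (H n)) sequentially"
        using mono_H unfolding eventually_sequentially by blast
    qed
    then show ?thesis by eventually_elim (auto simp: A_def)
  qed
  have ev: "eventually (\<lambda>n. x \<notin> (nbhd ^^ j) (A n)) sequentially" for x j
  proof (induction j arbitrary: x)
    case (Suc j)
    have "eventually (\<lambda>n. \<forall>y\<in>{y. (x, y) \<in> adj}. y \<notin> (nbhd ^^ j) (A n)) sequentially"
      using Suc by (intro eventually_ball_finite[OF finite_neighbours]) auto
    with Suc[of x] show ?case by eventually_elim (auto simp: nbhd_iff)
  qed (simp add: A_ev)
  let ?\<mu> = "completion \<mu>"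
  have fin_\<mu>: "finite_measure ?\<mu>"
    using finite_measure.emeasure_finite[OF \<mu>(1), of "space \<mu>"] by (intro finite_measureI) simp
  interpret finite_measure ?\<mu> by (rule fin_\<mu>)
  have U_sub: "sets U \<subseteq> sets ?\<mu>" by (rule sets_univ_completion_subset_completion[OF \<mu>])
  have "\<exists>n. measure ?\<mu> ((nbhd ^^ j) (A n)) < (1/2) ^ j" for j
  proof -
    have "(\<lambda>n. measure ?\<mu> ((nbhd ^^ j) (A n))) \<longlonglongrightarrow> measure ?\<mu> (\<Inter>n. (nbhd ^^ j) (A n))"
    proof (rule finite_Lim_measure_decseq)
      show "range (\<lambda>n. (nbhd ^^ j) (A n)) \<subseteq> sets ?\<mu>" using nbhd_pow_sets[OF A_sets] U_sub by blast
      show "decseq (\<lambda>n. (nbhd ^^ j) (A n))" using nbhd_pow_mono[OF A_dec] by (simp add: decseq_def)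
    qed
    also have "(\<Inter>n. (nbhd ^^ j) (A n)) = {}"
      using ev[of _ j] by (auto simp: eventually_sequentially)
    finally have "(\<lambda>n. measure ?\<mu> ((nbhd ^^ j) (A n))) \<longlonglongrightarrow> 0" by simp
    then have "eventually (\<lambda>n. measure ?\<mu> ((nbhd ^^ j) (A n)) < (1/2) ^ j) sequentially"
      by (rule order_tendstoD) simp
    then show ?thesis by (auto simp: eventually_sequentially)
  qed
  then obtain N where N: "\<And>j. measure ?\<mu> ((nbhd ^^ j) (A (N j))) < (1/2) ^ j" by metis
  define C' where "C' k = (\<Union>i. (nbhd ^^ i) (A (N (k + i))))" for k
  have C'_sets: "C' k \<in> sets U" for k using nbhd_pow_sets[OF A_sets] by (auto simp: C'_def)
  have C'_sp: "C' k \<subseteq> space X" for k using sets.sets_into_space[OF C'_sets] by simp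
  have nb_C': "nbhd (C' (Suc k)) \<subseteq> C' k" for k
  proof
    fix x assume "x \<in> nbhd (C' (Suc k))"
    then obtain i where "x \<in> nbhd ((nbhd ^^ i) (A (N (Suc k + i))))" by (auto simp: nbhd_def C'_def)
    then have "x \<in> (nbhd ^^ Suc i) (A (N (k + Suc i)))" by simp
    then show "x \<in> C' k" unfolding C'_def by blast
  qed
  define Z where "Z = (\<Inter>k. C' k)"
  have Z_sets: "Z \<in> sets U" using C'_sets by (auto simp: Z_def)
  have Z_null: "Z \<in> null_sets ?\<mu>"
  proof -
    have "limsup (\<lambda>j. (nbhd ^^ j) (A (N j))) \<in> null_sets ?\<mu>"
    proof (rule borel_cantelli_limsup1)
      show "summable (\<lambda>j. measure ?\<mu> ((nbhd ^^ j) (A (N j))))"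
        using N by (intro summable_comparison_test'[OF summable_geometric[of "1/2::real"]]) (auto intro: less_imp_le)
      show "(nbhd ^^ j) (A (N j)) \<in> sets ?\<mu>" for j using nbhd_pow_sets[OF A_sets] U_sub by blast
    qed (simp add: less_top[symmetric] del: emeasure_completion)
    moreover have "Z \<subseteq> limsup (\<lambda>j. (nbhd ^^ j) (A (N j)))"
    proof
      fix x assume x: "x \<in> Z"
      have "\<exists>j\<ge>k. x \<in> (nbhd ^^ j) (A (N j))" for k
      proof -
        obtain i where "x \<in> (nbhd ^^ i) (A (N (k + i)))" using x by (auto simp: Z_def C'_def)
        then have "x \<in> (nbhd ^^ (k + i)) (A (N (k + i)))" using nbhd_pow_le[OF A_sp, of i "k + i"] by auto
        then show ?thesis by (intro exI[of _ "k + i"]) auto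
      qed
      then show "x \<in> limsup (\<lambda>j. (nbhd ^^ j) (A (N j)))" by (auto simp: limsup_INF_SUP)
    qed
    ultimately show ?thesis using Z_sets U_sub by (auto intro: null_sets_subset)
  qed
  have Z_inv: "y \<in> Z" if "x \<in> Z" "(x, y) \<in> adj" for x y
  proof -
    have "(y, x) \<in> adj" "y \<in> space X" using that(2) sym_adj adj_subset by (auto dest: symD)
    moreover have "x \<in> C' (Suc k)" for k using that(1) by (auto simp: Z_def)
    ultimately have "y \<in> nbhd (C' (Suc k))" for k by (auto simp: nbhd_iff)
    then show ?thesis using nb_C' by (auto simp: Z_def)
  qed
  define C where "C k = (case k of 0 \<Rightarrow> space X | Suc m \<Rightarrow> C' m)" for k
  have nb_C: "nbhd (C (Suc k)) \<subseteq> C k" for k using nb_C' by (auto simp: C_def nbhd_def split: nat.split)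
  have C_sp: "C k \<subseteq> space X" for k using C'_sp by (auto simp: C_def split: nat.split)
  have "C k \<subseteq> nbhd (C k)" for k using C_sp[of k] by (auto simp: nbhd_iff)
  then have C_Suc: "C (Suc k) \<subseteq> C k" for k using nb_C by (rule order_trans)
  have C_dec: "C n \<subseteq> C m" if "m \<le> n" for m n using lift_Suc_antimono_le[of C, OF C_Suc that] .
  have C_sets: "C k \<in> sets U" for k
    using C'_sets sets.top[of U] by (auto simp: C_def split: nat.split)
  have AC: "A (N k) \<subseteq> C (Suc k)" for k
    by (auto simp: C_def C'_def intro!: exI[of _ 0])
  define lev where "lev x = (LEAST k. x \<notin> C (Suc k))" for x
  have [measurable]: "Measurable.pred U (\<lambda>x. x \<in> C k)" for k using C_sets[of k] by measurable
  have lev_meas[measurable]: "lev \<in> U \<rightarrow>\<^sub>M count_space UNIV" unfolding lev_def by measurable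
  have lev: "x \<in> C (lev x)" "x \<notin> C (Suc (lev x))" if "x \<in> space X - Z" for x
  proof -
    have "\<exists>k. x \<notin> C (Suc k)" using that by (auto simp: Z_def C_def)
    then show "x \<notin> C (Suc (lev x))" unfolding lev_def by (rule LeastI_ex)
    show "x \<in> C (lev x)"
    proof (cases "lev x")
      case 0
      then show ?thesis using that by (simp add: C_def)
    next
      case (Suc m)
      then have "m < (LEAST k. x \<notin> C (Suc k))" by (simp add: lev_def)
      then show ?thesis using not_less_Least[of m] Suc by auto
    qed
  qed
  have lev_le: "lev y \<le> Suc (lev x)" if "(x, y) \<in> adj" "x \<in> space X - Z" "y \<in> space X - Z" for x y
  proof (rule ccontr)
    assume "\<not> lev y \<le> Suc (lev x)"
    then have "y \<in> C (Suc (Suc (lev x)))" using lev(1)[OF that(3)] C_dec by (meson not_less_eq_eq subsetD)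
    then have "x \<in> nbhd (C (Suc (Suc (lev x))))" using that by (auto simp: nbhd_iff)
    then show False using nb_C lev(2)[OF that(2)] by auto
  qed
  define W where "W b = {x \<in> space X - Z. even (lev x) = b}" for b
  have W_sets: "W b \<in> sets U" for b
  proof -
    have "{x \<in> space U. even (lev x) = b} \<in> sets U" by measurable
    then have "{x \<in> space U. even (lev x) = b} - Z \<in> sets U" using Z_sets by (rule sets.Diff)
    also have "{x \<in> space U. even (lev x) = b} - Z = W b" by (auto simp: W_def)
    finally show ?thesis .
  qed
  have "finite {y. (x, y) \<in> (adj \<inter> W b \<times> W b)\<^sup>*}" if x: "x \<in> W b" for x b
  proof -
    have "(x, y) \<in> (snd (H (N (lev x))))\<^sup>* \<and> y \<in> W b \<and> lev y = lev x" if "(x, y) \<in> (adj \<inter> W b \<times> W b)\<^sup>*" for y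
      using that
    proof (induction)
      case base
      then show ?case using x by simp
    next
      case (step y z)
      have yz: "(y, z) \<in> adj" "(z, y) \<in> adj" "y \<in> space X - Z" "z \<in> space X - Z" "even (lev y) = even (lev z)"
        using step sym_adj by (auto simp: W_def dest: symD)
      have "lev z = lev y"
        using lev_le[OF yz(1,3,4)] lev_le[OF yz(2,4,3)] yz(5) by (auto simp: le_Suc_eq)
      moreover have "y \<notin> A (N (lev y))" using lev(2)[OF yz(3)] AC by blast
      then have "(y, z) \<in> snd (H (N (lev y)))" using yz by (auto simp: A_def)
      ultimately show ?case using step by (auto intro: rtrancl_into_rtrancl)
    qed
    then have "{y. (x, y) \<in> (adj \<inter> W b \<times> W b)\<^sup>*} \<subseteq> {y. (x, y) \<in> (snd (H (N (lev x))))\<^sup>*}" by blast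
    then show ?thesis using fin_H by (rule finite_subset)
  qed
  moreover have "W True \<inter> W False = {}" "W True \<union> W False = space X - Z" by (auto simp: W_def)
  ultimately show ?thesis using Z_null Z_inv W_sets by (intro exI[of _ Z] exI[of _ W]) blast
qed

end

section \<open>The measurable solution\<close>

lemma enumerated_cspI:
  assumes "sparse_csp (space X) q d \<B>" "standard_borel X" "borel_csp X q \<B>" "hyperfinite X (csp_graph (space X) \<B>)"
  shows "\<exists>f. enumerated_csp X q d \<B> f"
proof -
  interpret sparse_csp "space X" q d \<B> by fact
  obtain V :: "nat \<Rightarrow> 'a set" where V: "\<And>n. V n \<in> sets X"
    "\<And>F y. finite F \<Longrightarrow> F \<subseteq> space X \<Longrightarrow> y \<in> F \<Longrightarrow> \<exists>n. V n \<inter> F = {y}"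
    using countable_isolating_family[OF assms(2)] by blast
  let ?adj = "snd (csp_graph (space X) \<B>)"
  define diag where "diag = {p \<in> space X \<times> space X. fst p = snd p}"
  define E where "E = ?adj \<union> diag"
  have "diag = (\<Inter>n. (V n \<times> V n) \<union> ((space X - V n) \<times> (space X - V n)))"
  proof (intro equalityI subsetI)
    fix p assume p: "p \<in> (\<Inter>n. (V n \<times> V n) \<union> ((space X - V n) \<times> (space X - V n)))"
    obtain x y where xy: "p = (x, y)" by (cases p)
    have iff: "x \<in> V n \<longleftrightarrow> y \<in> V n" and sp: "x \<in> space X" "y \<in> space X" for n
      using p V(1)[THEN sets.sets_into_space] by (auto simp: xy)
    obtain n where n: "V n \<inter> {x, y} = {x}" using V(2)[of "{x, y}" x] sp by auto
    then have "x \<in> V n" by auto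
    then have "y \<in> V n \<inter> {x, y}" using iff by simp
    then show "p \<in> diag" using n sp by (simp add: xy diag_def)
  qed (auto simp: diag_def)
  also have "\<dots> \<in> sets (X \<Otimes>\<^sub>M X)" using V(1) by (intro sets.countable_INT) auto
  finally have "E \<in> sets (X \<Otimes>\<^sub>M X)"
    using assms(4) by (auto simp: E_def hyperfinite_def borel_graph_def)
  moreover have sec: "{y. (x, y) \<in> E} = insert x {y. (x, y) \<in> ?adj}" if "x \<in> space X" for x
    using that by (auto simp: E_def diag_def)
  moreover have "finite {y. (x, y) \<in> E}" if "x \<in> space X" for x
    using sec[OF that] finite_neighbours by simp
  moreover have "(x, x) \<in> E" if "x \<in> space X" for x using that by (simp add: E_def diag_def)
  ultimately obtain f :: "nat \<Rightarrow> 'a \<Rightarrow> 'a" where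
    "\<And>i. f i \<in> univ_completion X \<rightarrow>\<^sub>M univ_completion X"
    "\<And>x. x \<in> space X \<Longrightarrow> range (\<lambda>i. f i x) = insert x {y. (x, y) \<in> ?adj}"
    using measurable_enumeration_of_sections[OF assms(2)] by metis
  then have "enumerated_csp X q d \<B> f" using assms by unfold_locales auto
  then show ?thesis by blast
qed

lemma sparse_csp_of_csp_d:
  assumes "q > 0" "borel_csp X q \<B>" "csp_d \<B> = enat d"
  shows "sparse_csp (space X) q d \<B>"
proof
  show "q > 0" by fact
  show "\<B> \<subseteq> constraints (space X) q"
    using sets.sets_into_space[OF assms(2)[unfolded borel_csp_def]]
    by (auto simp: constraint_space_def space_restrict_space)
  fix B assume "B \<in> \<B>"
  then have "(if finite (constraint_nbrs \<B> B) then enat (card (constraint_nbrs \<B> B)) else \<infinity>) \<le> csp_d \<B>"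
    unfolding csp_d_def by (rule SUP_upper)
  then show "finite (constraint_nbrs \<B> B) \<and> card (constraint_nbrs \<B> B) \<le> d"
    by (auto simp: assms(3) split: if_splits)
qed

lemma constraint_prob_le_of_csp_p:
  assumes "csp_p q \<B> * (of_nat d + 1)\<^sup>2 \<le> ennreal (exp (- 2))" "B \<in> \<B>"
  shows "constraint_prob q B \<le> 1 / (exp 1 * (real d + 1))\<^sup>2"
proof -
  have r: "0 \<le> constraint_prob q B" by (simp add: constraint_prob_def)
  have "ennreal (constraint_prob q B) \<le> csp_p q \<B>" unfolding csp_p_def using assms(2) by (rule SUP_upper)
  then have "ennreal (constraint_prob q B) * (of_nat d + 1)\<^sup>2 \<le> csp_p q \<B> * (of_nat d + 1)\<^sup>2"
    by (rule mult_right_mono) simp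
  also have "\<dots> \<le> ennreal (exp (- 2))" by (rule assms(1))
  also have "(of_nat d + 1 :: ennreal) = ennreal (real d + 1)"
    by (simp add: ennreal_of_nat_eq_real_of_nat)
  also have "ennreal (constraint_prob q B) * (ennreal (real d + 1))\<^sup>2 = ennreal (constraint_prob q B * (real d + 1)\<^sup>2)"
    by (simp add: ennreal_power ennreal_mult r del: ennreal_plus)
  finally have "constraint_prob q B * (real d + 1)\<^sup>2 \<le> exp (- 2)" by simp
  then have "constraint_prob q B \<le> exp (- 2) / (real d + 1)\<^sup>2"
    by (subst pos_le_divide_eq) (auto intro!: zero_less_power add_nonneg_pos)
  also have "exp (- 2) = 1 / (exp (1::real))\<^sup>2" by (simp add: exp_minus inverse_eq_divide flip: exp_double)
  also have "1 / (exp 1)\<^sup>2 / (real d + 1)\<^sup>2 = 1 / (exp 1 * (real d + 1))\<^sup>2"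
    by (simp add: power_mult_distrib)
  finally show ?thesis .
qed

text \<open>
  A threshold \<open>s\<close> with \<open>s (e (d + 1))\<^sup>2 \<le> 1\<close> survives two rounds of extension: one over each part of the
  splitting. After the second round every constraint away from the null set \<open>Z\<close> has conditional
  probability below \<open>1\<close> and nothing left to be chosen, so it is satisfied.
\<close>

lemma (in enumerated_csp) measurable_solution:
  assumes \<mu>: "finite_measure \<mu>" "sets \<mu> = sets X" and hyp: "hyperfinite X (csp_graph (space X) \<B>)"
    and p: "\<And>B. B \<in> \<B> \<Longrightarrow> constraint_prob q B \<le> 1 / (exp 1 * (real d + 1))\<^sup>2"
  shows "\<exists>f. csp_solution (space X) q \<B> f \<and> mu_measurable \<mu> q f"
proof -
  define c where "c = exp 1 * (real d + 1)"
  have c: "1 \<le> c" using mult_mono[of 1 "exp 1" 1 "real d + 1"] by (simp add: c_def)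
  have p': "constraint_prob q B \<le> 1 / c\<^sup>2" if "B \<in> \<B>" for B using p[OF that] by (simp add: c_def)
  obtain Z W where Z0: "Z \<in> null_sets (completion \<mu>)" "\<forall>x\<in>Z. \<forall>y. (x, y) \<in> adj \<longrightarrow> y \<in> Z"
    and W0: "\<forall>b::bool. W b \<in> sets U" "W True \<inter> W False = {}" "W True \<union> W False = space X - Z"
      "\<forall>b. \<forall>x\<in>W b. finite {y. (x, y) \<in> (adj \<inter> W b \<times> W b)\<^sup>*}"
    using hyperfinite_split[OF \<mu> hyp] by (elim exE conjE) (rule that, assumption+)
  have Z: "Z \<in> null_sets (completion \<mu>)" "\<And>x y. x \<in> Z \<Longrightarrow> (x, y) \<in> adj \<Longrightarrow> y \<in> Z"
    using Z0 by blast+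
  have W: "\<And>b::bool. W b \<in> sets U" "W True \<inter> W False = {}" "W True \<union> W False = space X - Z"
      "\<And>b x. x \<in> W b \<Longrightarrow> finite {y. (x, y) \<in> (adj \<inter> W b \<times> W b)\<^sup>*}"
    using W0 by simp_all
  have "\<exists>g. g \<in> U \<rightarrow>\<^sub>M count_space UNIV \<and> ran g \<subseteq> {..<q} \<and> dom g = dom (Map.empty :: 'a \<rightharpoonup> nat) \<union> W True \<and>
      (\<forall>B\<in>\<B>. partial_prob q B g < 1 / c\<^sup>2 * c)"
    unfolding c_def by (rule measurable_extension) (use W p c in \<open>auto simp: c_def\<close>)
  then obtain g where g: "g \<in> U \<rightarrow>\<^sub>M count_space UNIV" "ran g \<subseteq> {..<q}" "dom g = W True"
    "\<And>B. B \<in> \<B> \<Longrightarrow> partial_prob q B g < 1 / c\<^sup>2 * c" by auto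
  have cc: "1 / c\<^sup>2 * c = 1 / c" using c by (simp add: power2_eq_square)
  have "\<exists>g'. g' \<in> U \<rightarrow>\<^sub>M count_space UNIV \<and> ran g' \<subseteq> {..<q} \<and> dom g' = dom g \<union> W False \<and>
      (\<forall>B\<in>\<B>. partial_prob q B g' < 1 / c * (exp 1 * (real d + 1)))"
  proof (rule measurable_extension[OF g(1,2) W(1)])
    show "W False \<inter> dom g = {}" using W(2) g(3) by auto
    show "0 < 1 / c" using c by simp
    show "partial_prob q B g \<le> 1 / c" if "B \<in> \<B>" for B using g(4)[OF that] cc by simp
  qed (use W(4) in auto)
  then obtain g' where g': "g' \<in> U \<rightarrow>\<^sub>M count_space UNIV" "ran g' \<subseteq> {..<q}" "dom g' = space X - Z"
    "\<And>B. B \<in> \<B> \<Longrightarrow> partial_prob q B g' < 1"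
    using W(3) g(3) c by (auto simp flip: c_def)
  have "\<exists>f. csp_solution (space X) q \<B> f"
  proof (rule solution_exists[where s="1 / c\<^sup>2"])
    show "1 / c\<^sup>2 * (exp 1 * (real d + 1)) \<le> 1" using cc c by (simp flip: c_def)
  qed (use p' c in auto)
  then obtain f0 where f0: "csp_solution (space X) q \<B> f0" by blast
  define f where "f x = (if x \<in> Z then f0 x else the (g' x))" for x
  have g'_Some: "g' x = Some (f x)" if "x \<in> space X - Z" for x
  proof -
    have "x \<in> dom g'" using that g'(3) by simp
    then show ?thesis using that by (auto simp: f_def)
  qed
  have "csp_solution (space X) q \<B> f"
    unfolding csp_solution_def
  proof (intro conjI ballI Pi_I)
    fix x assume "x \<in> space X"
    show "f x \<in> {..<q}"
    proof (cases "x \<in> Z")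
      case True
      then show ?thesis using f0 \<open>x \<in> space X\<close> by (auto simp: f_def csp_solution_def)
    next
      case False
      then have "f x \<in> ran g'" using g'_Some[of x] \<open>x \<in> space X\<close> by (auto intro: ranI)
      then show ?thesis using g'(2) by auto
    qed
  next
    fix B assume B: "B \<in> \<B>"
    then have Bc: "B \<in> constraints (space X) q" using constraints by auto
    show "\<not> violates f B"
    proof (cases "cdom B \<inter> Z = {}")
      case True
      show ?thesis
      proof (rule not_violates_if_partial_prob_less_1[OF Bc _ g'(4)[OF B]])
        show "g' x = Some (f x)" if "x \<in> cdom B" for x
          using that True constraintsD(3)[OF Bc] by (intro g'_Some) auto
      qed
    next
      case False
      then obtain x where x: "x \<in> cdom B" "x \<in> Z" by auto
      have "y \<in> Z" if "y \<in> cdom B" for y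
        using Z(2)[OF x(2), of y] adjI[OF B x(1) that] x(2) by (cases "x = y") auto
      then have "violates f B \<longleftrightarrow> violates f0 B"
        unfolding violates_iff[OF Bc] by (auto simp: f_def)
      then show ?thesis using f0 B by (auto simp: csp_solution_def)
    qed
  qed
  moreover have "mu_measurable \<mu> q f"
    unfolding mu_measurable_def
  proof (intro allI impI)
    fix i assume "i < q"
    have sp: "space \<mu> = space X" by (rule sets_eq_imp_space_eq[OF \<mu>(2)])
    have "g' -` {Some i} \<inter> space X \<in> sets U" using measurable_sets[OF g'(1), of "{Some i}"] by simp
    then have "g' -` {Some i} \<inter> space X \<in> sets (completion \<mu>)"
      using sets_univ_completion_subset_completion[OF \<mu>] by auto
    moreover have "f -` {i} \<inter> space X \<inter> Z \<in> null_sets (completion \<mu>)"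
      using Z(1) by (rule null_sets_completion_subset[rotated]) auto
    ultimately have "(g' -` {Some i} \<inter> space X) \<union> (f -` {i} \<inter> space X \<inter> Z) \<in> sets (completion \<mu>)"
      by (intro sets.Un) (auto simp: null_sets_def)
    also have "(g' -` {Some i} \<inter> space X) \<union> (f -` {i} \<inter> space X \<inter> Z) = f -` {i} \<inter> space \<mu>"
    proof (rule set_eqI)
      fix x
      show "x \<in> (g' -` {Some i} \<inter> space X) \<union> (f -` {i} \<inter> space X \<inter> Z) \<longleftrightarrow> x \<in> f -` {i} \<inter> space \<mu>"
      proof (cases "x \<in> space X - Z")
        case True
        then show ?thesis using g'_Some[OF True] by (auto simp: sp)
      next
        case False
        then have "x \<notin> dom g'" using g'(3) by simp
        then show ?thesis using False by (auto simp: sp)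
      qed
    qed
    finally show "f -` {i} \<inter> space \<mu> \<in> sets (completion \<mu>)" .
  qed
  ultimately show ?thesis by blast
qed

theorem corollary1p34:
  fixes X \<mu> :: "'a measure" and q :: nat and \<B> :: "'a constraint set"
  assumes "standard_borel X"
    and "q > 0"
    and "borel_csp X q \<B>"
    and "hyperfinite X (csp_graph (space X) \<B>)"
    and "csp_d \<B> < \<infinity>"
    and "csp_p q \<B> * (ennreal_of_enat (csp_d \<B>) + 1)\<^sup>2 \<le> ennreal (exp (- 2))"
    and "prob_space \<mu>"
    and "sets \<mu> = sets X"
  shows "\<exists>f. csp_solution (space X) q \<B> f \<and> mu_measurable \<mu> q f"
proof -
  obtain d where d: "csp_d \<B> = enat d" using assms(5) by auto
  have "csp_p q \<B> * (of_nat d + 1)\<^sup>2 \<le> ennreal (exp (- 2))" using assms(6) by (simp add: d)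
  note p = constraint_prob_le_of_csp_p[OF this]
  obtain f where "enumerated_csp X q d \<B> f"
    using enumerated_cspI[OF sparse_csp_of_csp_d[OF assms(2,3) d] assms(1,3,4)] by blast
  then interpret enumerated_csp X q d \<B> f .
  show ?thesis
    using measurable_solution[OF prob_space.finite_measure[OF assms(7)] assms(8,4) p] by blast
qed

end
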